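(* Let $P$ be a finite naturally labeled poset of width at most $2$. Then $P$ is uniquely determined by $K_P(\mathbf{x})$: if $Q$ is a finite naturally labeled poset with $K_Q(\mathbf{x})=K_P(\mathbf{x})$, then $Q\cong P$. Moreover, if $P$ is irreducible, then $P$ has a unique partition $P=C_1\sqcup C_2$ into two chains, up to reordering of $C_1$ and $C_2$.
   Context: A poset $(P,\preceq)$ on ground set $[n]=\{1,\dots,n\}$ is naturally labeled if $x\preceq y$ implies $x\le y$ as integers. For such $P$, the $P$-partition generating function is $K_P(\mathbf{x})=\sum_{\sigma}\prod_{p\in P}x_{\sigma(p)}$, the sum over all maps $\sigma:P\to\mathbb{Z}^+$ with $\sigma(x)\le\sigma(y)$ whenever $x\preceq y$. The width of a poset is the maximum size of an antichain. The ordinal sum $Q\oplus R$ of posets is the poset on $Q\sqcup R$ where $x\preceq y$ iff $x\preceq_Q y$, or $x\preceq_R y$, or $x\in Q$ and $y\in R$. A finite poset $P$ is irreducible if $P=Q\oplus R$ implies $Q=\varnothing$ or $R=\varnothing$. *)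

theory Defs
  imports "HOL-Library.FuncSet" "HOL-Library.Poly_Mapping"
begin

text \<open>
  A finite poset is given by its ground set \<open>A\<close> and its (reflexive) order relation
  \<open>r \<subseteq> A \<times> A\<close> with \<open>partial_order_on A r\<close>.  Chains are the library's \<open>Chains r\<close>;
  as \<open>r\<close> is reflexive only on \<open>A\<close>, these are subsets of \<open>A\<close>.
\<close>

definition naturally_labeled :: "nat \<Rightarrow> (nat \<times> nat) set \<Rightarrow> bool" where
  "naturally_labeled n r \<longleftrightarrow> partial_order_on {1..n} r \<and> (\<forall>(x, y)\<in>r. x \<le> y)"

definition antichain :: "'a set \<Rightarrow> ('a \<times> 'a) set \<Rightarrow> 'a set \<Rightarrow> bool" where
  "antichain A r S \<longleftrightarrow> S \<subseteq> A \<and> (\<forall>x\<in>S. \<forall>y\<in>S. x \<noteq> y \<longrightarrow> (x, y) \<notin> r)"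

definition poset_width :: "'a set \<Rightarrow> ('a \<times> 'a) set \<Rightarrow> nat" where
  "poset_width A r = Max (card ` {S. antichain A r S})"

definition poset_iso :: "'a set \<Rightarrow> ('a \<times> 'a) set \<Rightarrow> 'b set \<Rightarrow> ('b \<times> 'b) set \<Rightarrow> bool" where
  "poset_iso A r B s \<longleftrightarrow>
     (\<exists>f. bij_betw f A B \<and> (\<forall>x\<in>A. \<forall>y\<in>A. (x, y) \<in> r \<longleftrightarrow> (f x, f y) \<in> s))"

text \<open>The order relation of the ordinal sum; its ground set is \<open>A <+> B\<close>.\<close>

definition ordinal_sum ::
    "'a set \<Rightarrow> ('a \<times> 'a) set \<Rightarrow> 'b set \<Rightarrow> ('b \<times> 'b) set \<Rightarrow> (('a + 'b) \<times> ('a + 'b)) set" where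
  "ordinal_sum A r B s =
     {(Inl x, Inl y) | x y. (x, y) \<in> r} \<union>
     {(Inr x, Inr y) | x y. (x, y) \<in> s} \<union>
     {(Inl x, Inr y) | x y. x \<in> A \<and> y \<in> B}"

text \<open>
  Equality with an ordinal sum is read up to isomorphism.  Taking both summands on the same
  type as \<open>A\<close> is no restriction, since they embed into \<open>A\<close>.  With this definition the empty
  poset is irreducible.
\<close>

definition irreducible_poset :: "'a set \<Rightarrow> ('a \<times> 'a) set \<Rightarrow> bool" where
  "irreducible_poset A r \<longleftrightarrow>
     (\<forall>(B :: 'a set) s (C :: 'a set) t.
        partial_order_on B s \<and> partial_order_on C t \<and>
        poset_iso A r (B <+> C) (ordinal_sum B s C t) \<longrightarrow> B = {} \<or> C = {})"

text \<open>The two chains are ordered and either may be empty (as it must be for a one-point poset).\<close>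

definition two_chain_partition ::
    "'a set \<Rightarrow> ('a \<times> 'a) set \<Rightarrow> 'a set \<Rightarrow> 'a set \<Rightarrow> bool" where
  "two_chain_partition A r C\<^sub>1 C\<^sub>2 \<longleftrightarrow>
     C\<^sub>1 \<in> Chains r \<and> C\<^sub>2 \<in> Chains r \<and> C\<^sub>1 \<union> C\<^sub>2 = A \<and> C\<^sub>1 \<inter> C\<^sub>2 = {}"

text \<open>Maps are extensional (undefined outside \<open>A\<close>), so that each map on \<open>A\<close> occurs exactly once.\<close>

definition P_partitions :: "'a set \<Rightarrow> ('a \<times> 'a) set \<Rightarrow> ('a \<Rightarrow> nat) set" where
  "P_partitions A r = {\<sigma> \<in> A \<rightarrow>\<^sub>E {1..}. \<forall>(x, y)\<in>r. \<sigma> x \<le> \<sigma> y}"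

text \<open>
  Polynomials in the variables \<open>x\<^sub>1, x\<^sub>2, \<dots>\<close> are finitely supported maps from exponent vectors
  (of type \<open>nat \<Rightarrow>\<^sub>0 nat\<close>) to integers; formal power series in these variables are arbitrary maps
  from exponent vectors to integers.
\<close>

type_synonym power_series = "(nat \<Rightarrow>\<^sub>0 nat) \<Rightarrow> int"

definition var :: "nat \<Rightarrow> (nat \<Rightarrow>\<^sub>0 nat) \<Rightarrow>\<^sub>0 int" where
  "var i = Poly_Mapping.single (Poly_Mapping.single i 1) 1"

text \<open>
  The sum of the monomials \<open>\<Prod>p\<in>A. x\<^bsub>\<sigma> p\<^esub>\<close> over all \<open>P\<close>-partitions \<open>\<sigma>\<close>, taken coefficientwise:
  the coefficient at \<open>\<alpha>\<close> is a sum with finitely many nonzero terms (see below).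
\<close>

definition K :: "'a set \<Rightarrow> ('a \<times> 'a) set \<Rightarrow> power_series" where
  "K A r = (\<lambda>\<alpha>. \<Sum>\<sigma> | \<sigma> \<in> P_partitions A r \<and> Poly_Mapping.lookup (\<Prod>p\<in>A. var (\<sigma> p)) \<alpha> \<noteq> 0.
                    Poly_Mapping.lookup (\<Prod>p\<in>A. var (\<sigma> p)) \<alpha>)"

lemma prod_var:
  "(\<Prod>p\<in>A. var (\<sigma> p)) = Poly_Mapping.single (\<Sum>p\<in>A. Poly_Mapping.single (\<sigma> p) 1) 1"
  by (induction A rule: infinite_finite_induct) (simp_all add: var_def mult_single)

lemma finite_K_support:
  assumes "finite A"
  shows "finite {\<sigma> \<in> P_partitions A r. Poly_Mapping.lookup (\<Prod>p\<in>A. var (\<sigma> p)) \<alpha> \<noteq> 0}"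
proof (rule finite_subset)
  show "{\<sigma> \<in> P_partitions A r. Poly_Mapping.lookup (\<Prod>p\<in>A. var (\<sigma> p)) \<alpha> \<noteq> 0} \<subseteq> A \<rightarrow>\<^sub>E Poly_Mapping.keys \<alpha>"
  proof
    fix \<sigma> assume "\<sigma> \<in> {\<sigma> \<in> P_partitions A r. Poly_Mapping.lookup (\<Prod>p\<in>A. var (\<sigma> p)) \<alpha> \<noteq> 0}"
    then have \<sigma>: "\<sigma> \<in> A \<rightarrow>\<^sub>E {1..}" and nz: "Poly_Mapping.lookup (\<Prod>p\<in>A. var (\<sigma> p)) \<alpha> \<noteq> 0"
      by (auto simp: P_partitions_def)
    from nz have \<alpha>: "\<alpha> = (\<Sum>p\<in>A. Poly_Mapping.single (\<sigma> p) 1)"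
      by (auto simp: prod_var lookup_single when_def split: if_splits)
    have "\<sigma> q \<in> Poly_Mapping.keys \<alpha>" if "q \<in> A" for q
    proof -
      have "Poly_Mapping.lookup (Poly_Mapping.single (\<sigma> q) (1::nat)) (\<sigma> q) \<le> Poly_Mapping.lookup \<alpha> (\<sigma> q)"
        unfolding \<alpha> lookup_sum using assms that by (intro member_le_sum) auto
      then show ?thesis by (simp add: in_keys_iff)
    qed
    with \<sigma> show "\<sigma> \<in> A \<rightarrow>\<^sub>E Poly_Mapping.keys \<alpha>" by (auto simp: PiE_def)
  qed
  show "finite (A \<rightarrow>\<^sub>E Poly_Mapping.keys \<alpha>)" using assms by (intro finite_PiE) auto
qed

end

theory Submission
  imports Defs
begin

text \<open>
  The coefficients of \<open>K\<close> count multichains of order ideals with prescribed cardinalities.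
  Given a partition of a poset of width two into chains \<open>C\<^sub>1, C\<^sub>2\<close>, an ideal \<open>I\<close> is determined by its
  rank \<open>card I\<close> and its coordinate \<open>card (I \<inter> C\<^sub>1)\<close>; the coordinates at rank \<open>t\<close> fill an integer interval
  whose endpoints move by 0 or 1 from rank to rank, and these intervals determine the poset.  Since
  \<open>K\<close> yields their lengths, the only ambiguity is the direction of the ``flat'' steps, where both
  endpoints move together.  The relative direction of two consecutive flat steps is read off the
  number of saturated chains between them: the part of the region in between is symmetric, and by
  reflection more chains run along one side of it than across.  A common reversal of all flat
  steps between two ranks with a single ideal only amounts to exchanging the two chains there.
\<close>

section \<open>Order ideals\<close>

text \<open>The coefficients of \<open>K\<close> are totals over whole ranks: they do not tell how
  many saturated chains end at a given ideal. The number at a corner of the region becomes visible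
  through the flat step after it. Every chain has two continuations, except that one is lost at a
  single corner: the upper one if the endpoints stay, the lower one if both move up. So if two
  regions agree up to rank \<open>j\<close> and then take flat steps in opposite directions, equal
  totals force equal numbers of chains at the two corners of rank \<open>j\<close>, counted from any
  earlier rank. Counted from the last flat step before \<open>j\<close>, these are the two numbers
  that the reflection argument separates.

  The second poset is not assumed to have width two, so no chain partition of it is at hand. Its
  width has to be read off from \<open>K\<close> beforehand, which is done by counting the maximal
  elements of its ideals.

  The uniqueness of the chain partition does not involve \<open>K\<close>. It is a comparability
  argument: the elements on which two partitions agree are comparable to all those on which they
  disagree, and such a split produces an ordinal sum.\<close>

locale fin_poset =
  fixes A :: "'a set" and r :: "('a \<times> 'a) set"
  assumes finite_ground: "finite A"
    and order: "partial_order_on A r"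
begin

lemma rel_in: "(x, y) \<in> r \<Longrightarrow> x \<in> A \<and> y \<in> A"
  using order unfolding partial_order_on_def preorder_on_def by blast

lemma refl_rel: "x \<in> A \<Longrightarrow> (x, x) \<in> r"
  using order unfolding partial_order_on_def preorder_on_def refl_on_def by blast

lemma trans_rel: "(x, y) \<in> r \<Longrightarrow> (y, z) \<in> r \<Longrightarrow> (x, z) \<in> r"
  using order unfolding partial_order_on_def preorder_on_def trans_def by blast

lemma antisym_rel: "(x, y) \<in> r \<Longrightarrow> (y, x) \<in> r \<Longrightarrow> x = y"
  using order unfolding partial_order_on_def antisym_def by blast

definition ideal :: "'a set \<Rightarrow> bool" where
  "ideal I \<longleftrightarrow> I \<subseteq> A \<and> (\<forall>x y. (x, y) \<in> r \<longrightarrow> y \<in> I \<longrightarrow> x \<in> I)"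

definition ideals :: "nat \<Rightarrow> 'a set set" where
  "ideals k = {I. ideal I \<and> card I = k}"

definition maxs :: "'a set \<Rightarrow> 'a set" where
  "maxs I = {x \<in> I. \<forall>y\<in>I. (x, y) \<in> r \<longrightarrow> y = x}"

definition down :: "'a \<Rightarrow> 'a set" where
  "down x = {y. (y, x) \<in> r}"

lemma idealD: "ideal I \<Longrightarrow> (x, y) \<in> r \<Longrightarrow> y \<in> I \<Longrightarrow> x \<in> I"
  unfolding ideal_def by blast

lemma ideal_subset: "ideal I \<Longrightarrow> I \<subseteq> A"
  unfolding ideal_def by blast

lemma ideal_finite: "ideal I \<Longrightarrow> finite I"
  using finite_subset[OF ideal_subset finite_ground] .

lemma ideal_empty: "ideal {}"
  unfolding ideal_def by blast

lemma ideal_ground: "ideal A"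
  unfolding ideal_def using rel_in by blast

lemma ideal_down: "ideal (down x)"
  unfolding ideal_def down_def by (auto dest: rel_in trans_rel)

lemma down_subset: "ideal I \<Longrightarrow> x \<in> I \<Longrightarrow> down x \<subseteq> I"
  unfolding ideal_def down_def by blast

lemma down_self: "x \<in> A \<Longrightarrow> x \<in> down x"
  unfolding down_def using refl_rel by blast

lemma finite_ideals: "finite (ideals k)"
proof (rule finite_subset)
  show "ideals k \<subseteq> Pow A" unfolding ideals_def ideal_def by blast
  show "finite (Pow A)" using finite_ground by blast
qed

lemma finite_ideals_below: "finite {J \<in> ideals k. J \<subseteq> I}"
  using finite_ideals by simp

lemma ideals_zero: "ideals 0 = {{}}"
  unfolding ideals_def using ideal_finite ideal_empty by auto

lemma ideals_top: "ideals (card A) = {A}"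
  unfolding ideals_def using ideal_ground card_subset_eq[OF finite_ground ideal_subset] by auto

lemma ideals_card_le: "I \<in> ideals k \<Longrightarrow> k \<le> card A"
  unfolding ideals_def using card_mono[OF finite_ground ideal_subset] by blast

lemma finite_maxs: "ideal J \<Longrightarrow> finite (maxs J)"
  unfolding maxs_def using ideal_finite by simp

lemma max_exists:
  assumes "finite S" "S \<noteq> {}" "S \<subseteq> A"
  shows "\<exists>x\<in>S. \<forall>y\<in>S. (x, y) \<in> r \<longrightarrow> y = x"
proof -
  \<comment> \<open>An element of \<open>S\<close> whose down-set is largest is maximal: the
    down-set of anything above it contains its own, so the two coincide.\<close>
  let ?h = "\<lambda>y. card (down y)"
  have "Max (?h ` S) \<in> ?h ` S" using assms by simp
  then obtain x where x: "x \<in> S" "?h x = Max (?h ` S)" by auto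
  have le: "?h y \<le> ?h x" if "y \<in> S" for y
    using that assms(1) unfolding x(2) by simp
  have "y = x" if "y \<in> S" "(x, y) \<in> r" for y
  proof -
    have "down x \<subseteq> down y" using trans_rel[OF _ that(2)] unfolding down_def by blast
    moreover have "finite (down y)" by (rule ideal_finite[OF ideal_down])
    ultimately have "down x = down y" using le[OF that(1)]
      by (intro card_seteq)
    moreover have "y \<in> down y" using down_self[of y] that(1) assms(3) by blast
    ultimately have "y \<in> down x" by simp
    then show ?thesis using antisym_rel[OF that(2)] unfolding down_def by simp
  qed
  with x(1) show ?thesis by (intro bexI[of _ x]) simp_all
qed

lemma min_exists:
  assumes "finite S" "S \<noteq> {}" "S \<subseteq> A"
  shows "\<exists>x\<in>S. \<forall>y\<in>S. (y, x) \<in> r \<longrightarrow> y = x"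
proof -
  have "partial_order_on A (r\<inverse>)" using order by simp
  then interpret d: fin_poset A "r\<inverse>" using finite_ground by unfold_locales
  show ?thesis using d.max_exists[OF assms] by simp
qed

lemma maxs_nonempty: "ideal J \<Longrightarrow> J \<noteq> {} \<Longrightarrow> maxs J \<noteq> {}"
  using max_exists[of J] ideal_finite ideal_subset unfolding maxs_def by blast

lemma ideal_remove_max: "ideal J \<Longrightarrow> x \<in> maxs J \<Longrightarrow> ideal (J - {x})"
  unfolding ideal_def maxs_def by blast

lemma ideal_insert:
  assumes "ideal I" "x \<in> A" "\<And>y. (y, x) \<in> r \<Longrightarrow> y \<noteq> x \<Longrightarrow> y \<in> I"
  shows "ideal (insert x I)"
  using assms unfolding ideal_def by blast

text \<open>The one element of \<open>J - I\<close> is maximal in \<open>J\<close>: an element of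
  \<open>J\<close> strictly above it would lie in \<open>I\<close> and pull it into
  \<open>I\<close>.\<close>

lemma ideals_lower_cover:
  assumes "J \<in> ideals (Suc k)"
  shows "{I \<in> ideals k. I \<subseteq> J} = (\<lambda>x. J - {x}) ` maxs J"
proof (intro equalityI subsetI)
  have J: "ideal J" "card J = Suc k" "finite J" using assms ideal_finite unfolding ideals_def by auto
  {
    fix I assume "I \<in> {I \<in> ideals k. I \<subseteq> J}"
    then have I: "ideal I" "card I = k" "I \<subseteq> J" unfolding ideals_def by auto
    have "card (J - I) = 1" using I J by (simp add: card_Diff_subset ideal_finite)
    then obtain x where x: "J - I = {x}" using card_1_singletonE by blast
    have "y = x" if "y \<in> J" "(x, y) \<in> r" for y
      using that x idealD[OF I(1) that(2)] by blast
    then have "x \<in> maxs J" using x unfolding maxs_def by blast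
    moreover have "I = J - {x}" using x I(3) by blast
    ultimately show "I \<in> (\<lambda>x. J - {x}) ` maxs J" by blast
  }
  {
    fix I assume "I \<in> (\<lambda>x. J - {x}) ` maxs J"
    then obtain x where "x \<in> maxs J" "I = J - {x}" by blast
    then show "I \<in> {I \<in> ideals k. I \<subseteq> J}"
      using ideal_remove_max[OF J(1)] J unfolding ideals_def maxs_def by simp
  }
qed

lemma inj_remove: "S \<subseteq> J \<Longrightarrow> inj_on (\<lambda>x. J - {x}) S"
  by (auto simp: inj_on_def)

lemma maxs_subset: "maxs J \<subseteq> J"
  unfolding maxs_def by blast

lemma sum_lower_covers:
  assumes "J \<in> ideals (Suc k)"
  shows "(\<Sum>I | I \<in> ideals k \<and> I \<subseteq> J. f I) = (\<Sum>x\<in>maxs J. f (J - {x}))"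
  unfolding ideals_lower_cover[OF assms]
  by (simp add: sum.reindex[OF inj_remove[OF maxs_subset]])

text \<open>A minimal element of \<open>J - I\<close> can be added to \<open>I\<close> without
  losing the ideal property, so the ranks are climbed one by one.\<close>

lemma ideal_between:
  assumes "ideal I" "ideal J" "I \<subseteq> J" "card I \<le> k" "k \<le> card J"
  shows "\<exists>M\<in>ideals k. I \<subseteq> M \<and> M \<subseteq> J"
  using assms
proof (induction "k - card I" arbitrary: I)
  case 0
  then show ?case unfolding ideals_def by auto
next
  case (Suc d)
  have "J - I \<noteq> {}"
  proof
    assume "J - I = {}"
    then have "I = J" using Suc(5) by blast
    then show False using Suc(2,7) by simp
  qed
  then obtain x where x: "x \<in> J - I" "\<forall>y\<in>J - I. (y, x) \<in> r \<longrightarrow> y = x"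
    using min_exists[of "J - I"] ideal_finite[OF Suc(4)] ideal_subset[OF Suc(4)] by blast
  have "ideal (insert x I)"
  proof (rule ideal_insert[OF Suc(3)])
    show "x \<in> A" using x ideal_subset[OF Suc(4)] by blast
    show "y \<in> I" if "(y, x) \<in> r" "y \<noteq> x" for y
      using x that idealD[OF Suc(4) that(1)] by blast
  qed
  moreover have "card (insert x I) = Suc (card I)" using x ideal_finite[OF Suc(3)] by simp
  moreover have "insert x I \<subseteq> J" using x Suc(5) by blast
  moreover have "Suc (card I) \<le> k" "d = k - Suc (card I)" using Suc(2) by auto
  ultimately have "\<exists>M\<in>ideals k. insert x I \<subseteq> M \<and> M \<subseteq> J"
    using Suc(1)[of "insert x I"] Suc(4,7) by simp
  then show ?case by blast
qed

lemma chain_nested: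
  assumes "ideal I" "ideal J" "C \<in> Chains r"
  shows "I \<inter> C \<subseteq> J \<inter> C \<or> J \<inter> C \<subseteq> I \<inter> C"
proof (rule ccontr)
  assume "\<not> ?thesis"
  then obtain x y where xy: "x \<in> I" "x \<in> C" "x \<notin> J" "y \<in> J" "y \<in> C" "y \<notin> I" by blast
  then have "(x, y) \<in> r \<or> (y, x) \<in> r" using assms(3) unfolding Chains_def by blast
  then show False using xy idealD[OF assms(1)] idealD[OF assms(2)] by metis
qed

text \<open>Ideals meet a chain in initial segments, so sizes can stand for the intersections. This
  is what turns ideals into tuples of numbers.\<close>

lemma chain_card_le:
  assumes "ideal I" "ideal J" "C \<in> Chains r" "card (I \<inter> C) \<le> card (J \<inter> C)"
  shows "I \<inter> C \<subseteq> J \<inter> C"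
  using chain_nested[OF assms(1-3)] assms(4) ideal_finite[OF assms(1)]
  by (metis card_seteq finite_Int order_refl)

end

section \<open>Coefficients of \<open>K\<close>\<close>

context fin_poset
begin

text \<open>Counts the multichains of ideals inside \<open>I\<close> that start at the empty ideal
  and have sizes \<open>\<rho> s\<close> for \<open>s < t\<close>; \<open>I\<close> itself takes the
  place of the level \<open>t\<close>.\<close>

primrec chain_count :: "nat \<Rightarrow> (nat \<Rightarrow> nat) \<Rightarrow> 'a set \<Rightarrow> nat" where
  "chain_count 0 \<rho> I = (if I = {} then 1 else 0)"
| "chain_count (Suc t) \<rho> I = (\<Sum>J | J \<in> ideals (\<rho> t) \<and> J \<subseteq> I. chain_count t \<rho> J)"

text \<open>Sizes of sublevel sets are prescribed rather than sizes of fibres, because the sublevel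
  sets of an order-preserving map are the members of a multichain of ideals.\<close>

definition level_maps :: "nat \<Rightarrow> (nat \<Rightarrow> nat) \<Rightarrow> 'a set \<Rightarrow> ('a \<Rightarrow> nat) set" where
  "level_maps t \<rho> I = {\<sigma> \<in> I \<rightarrow>\<^sub>E {1..t}.
     (\<forall>x\<in>I. \<forall>y\<in>I. (x, y) \<in> r \<longrightarrow> \<sigma> x \<le> \<sigma> y) \<and> (\<forall>s<t. card {x \<in> I. \<sigma> x \<le> s} = \<rho> s)}"

lemma finite_level_maps:
  assumes "ideal I"
  shows "finite (level_maps t \<rho> I)"
proof (rule finite_subset)
  show "level_maps t \<rho> I \<subseteq> I \<rightarrow>\<^sub>E {1..t}" unfolding level_maps_def by blast
  show "finite (I \<rightarrow>\<^sub>E {1..t})" using ideal_finite[OF assms] by (intro finite_PiE) auto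
qed

text \<open>A map is recovered from its sublevel set at \<open>t\<close> and the restriction to it,
  since all remaining elements take the value \<open>Suc t\<close>. This mirrors the recursion of
  \<open>chain_count\<close>.\<close>

lemma bij_level_maps:
  assumes I: "ideal I"
  shows "bij_betw (\<lambda>\<sigma>. ({x \<in> I. \<sigma> x \<le> t}, restrict \<sigma> {x \<in> I. \<sigma> x \<le> t}))
           (level_maps (Suc t) \<rho> I)
           (SIGMA J:{J \<in> ideals (\<rho> t). J \<subseteq> I}. level_maps t \<rho> J)"
    (is "bij_betw ?f ?L ?R")
proof (rule bij_betw_byWitness[where f' = "\<lambda>(J, \<tau>). \<lambda>x\<in>I. if x \<in> J then \<tau> x else Suc t"])
  let ?g = "\<lambda>(J, \<tau>). \<lambda>x\<in>I. if x \<in> J then \<tau> x else Suc t"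
  show "\<forall>\<sigma>\<in>?L. ?g (?f \<sigma>) = \<sigma>"
  proof
    fix \<sigma> assume "\<sigma> \<in> ?L"
    then have \<sigma>: "\<sigma> \<in> I \<rightarrow>\<^sub>E {1..Suc t}" unfolding level_maps_def by blast
    show "?g (?f \<sigma>) = \<sigma>"
    proof
      fix x
      show "?g (?f \<sigma>) x = \<sigma> x"
        using PiE_mem[OF \<sigma>, of x] PiE_arb[OF \<sigma>, of x] by (cases "x \<in> I") auto
    qed
  qed
  show "\<forall>p\<in>?R. ?f (?g p) = p"
  proof
    fix p assume "p \<in> ?R"
    then obtain J \<tau> where p: "p = (J, \<tau>)" "J \<subseteq> I" and \<tau>: "\<tau> \<in> J \<rightarrow>\<^sub>E {1..t}"
      unfolding level_maps_def by blast
    have "{x \<in> I. ?g p x \<le> t} = J"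
      using p PiE_mem[OF \<tau>] by auto
    moreover have "restrict (?g p) J = \<tau>"
    proof
      fix x
      show "restrict (?g p) J x = \<tau> x"
        using p PiE_arb[OF \<tau>, of x] by (cases "x \<in> J") auto
    qed
    ultimately show "?f (?g p) = p" using p(1) by simp
  qed
  show "?f ` ?L \<subseteq> ?R"
  proof (intro image_subsetI)
    fix \<sigma> assume "\<sigma> \<in> ?L"
    then have \<sigma>: "\<sigma> \<in> I \<rightarrow>\<^sub>E {1..Suc t}"
      and mono: "\<And>x y. x \<in> I \<Longrightarrow> y \<in> I \<Longrightarrow> (x, y) \<in> r \<Longrightarrow> \<sigma> x \<le> \<sigma> y"
      and crd: "\<And>s. s < Suc t \<Longrightarrow> card {x \<in> I. \<sigma> x \<le> s} = \<rho> s" unfolding level_maps_def by auto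
    let ?J = "{x \<in> I. \<sigma> x \<le> t}"
    have "ideal ?J"
      unfolding ideal_def
    proof (intro conjI allI impI)
      show "?J \<subseteq> A" using ideal_subset[OF I] by blast
      fix x y assume "(x, y) \<in> r" "y \<in> ?J"
      then show "x \<in> ?J" using mono[of x y] idealD[OF I, of x y] by simp
    qed
    then have J: "?J \<in> ideals (\<rho> t)" using crd[of t] unfolding ideals_def by simp
    have "restrict \<sigma> ?J \<in> level_maps t \<rho> ?J"
      unfolding level_maps_def
    proof (intro CollectI conjI ballI impI allI)
      show "restrict \<sigma> ?J \<in> ?J \<rightarrow>\<^sub>E {1..t}" using PiE_mem[OF \<sigma>] by force
      show "restrict \<sigma> ?J x \<le> restrict \<sigma> ?J y" if "x \<in> ?J" "y \<in> ?J" "(x, y) \<in> r" for x y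
        using that mono by simp
      show "card {x \<in> ?J. restrict \<sigma> ?J x \<le> s} = \<rho> s" if "s < t" for s
      proof -
        have "{x \<in> ?J. restrict \<sigma> ?J x \<le> s} = {x \<in> I. \<sigma> x \<le> s}" using that by auto
        then show ?thesis using crd[of s] that by simp
      qed
    qed
    with J show "?f \<sigma> \<in> ?R" by simp
  qed
  show "?g ` ?R \<subseteq> ?L"
  proof (intro image_subsetI)
    fix p assume "p \<in> ?R"
    then obtain J \<tau> where p: "p = (J, \<tau>)" and JI: "J \<subseteq> I" and J: "J \<in> ideals (\<rho> t)"
      and \<tau>: "\<tau> \<in> J \<rightarrow>\<^sub>E {1..t}"
      and mono: "\<And>x y. x \<in> J \<Longrightarrow> y \<in> J \<Longrightarrow> (x, y) \<in> r \<Longrightarrow> \<tau> x \<le> \<tau> y"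
      and crd: "\<And>s. s < t \<Longrightarrow> card {x \<in> J. \<tau> x \<le> s} = \<rho> s"
      unfolding level_maps_def by blast
    have range: "1 \<le> \<tau> x \<and> \<tau> x \<le> t" if "x \<in> J" for x using PiE_mem[OF \<tau> that] by simp
    have iJ: "ideal J" "card J = \<rho> t" using J unfolding ideals_def by auto
    have "?g p \<in> I \<rightarrow>\<^sub>E {1..Suc t}" using p range by (force simp: le_Suc_eq)
    moreover have "?g p x \<le> ?g p y" if "x \<in> I" "y \<in> I" "(x, y) \<in> r" for x y
      using that p idealD[OF iJ(1) that(3)] mono[OF _ _ that(3)] range[of x] by auto
    moreover have "card {x \<in> I. ?g p x \<le> s} = \<rho> s" if s: "s < Suc t" for s
    proof -
      have "{x \<in> I. ?g p x \<le> s} = {x \<in> J. \<tau> x \<le> s}" using s JI p by auto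
      moreover have "{x \<in> J. \<tau> x \<le> t} = J" using range by auto
      ultimately show ?thesis using crd[of s] iJ(2) s by (cases "s = t") auto
    qed
    ultimately show "?g p \<in> ?L" unfolding level_maps_def by blast
  qed
qed

lemma card_level_maps:
  "ideal I \<Longrightarrow> card (level_maps t \<rho> I) = chain_count t \<rho> I"
proof (induction t arbitrary: I)
  case 0
  show ?case
  proof (cases "I = {}")
    case True
    then have "level_maps 0 \<rho> I = {\<lambda>x. undefined}" unfolding level_maps_def by auto
    then show ?thesis using True by simp
  next
    case False
    then have "level_maps 0 \<rho> I = {}" unfolding level_maps_def by (auto simp: PiE_eq_empty_iff)
    then show ?thesis using False by simp
  qed
next
  case (Suc t)
  have "card (level_maps (Suc t) \<rho> I) = card (SIGMA J:{J \<in> ideals (\<rho> t). J \<subseteq> I}. level_maps t \<rho> J)"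
    using bij_level_maps[OF Suc.prems] by (rule bij_betw_same_card)
  also have "\<dots> = (\<Sum>J | J \<in> ideals (\<rho> t) \<and> J \<subseteq> I. card (level_maps t \<rho> J))"
    using finite_ideals_below finite_level_maps by (subst card_SigmaI) (auto simp: ideals_def)
  also have "\<dots> = chain_count (Suc t) \<rho> I"
    using Suc.IH by (auto simp: ideals_def intro!: sum.cong)
  finally show ?case .
qed

lemma K_eq_card:
  "K A r \<alpha> = int (card {\<sigma> \<in> P_partitions A r. \<forall>s. card {x \<in> A. \<sigma> x = s} = Poly_Mapping.lookup \<alpha> s})"
proof -
  have lk: "Poly_Mapping.lookup (\<Sum>p\<in>A. Poly_Mapping.single (\<sigma> p) 1) s = card {x \<in> A. \<sigma> x = s}"
    for \<sigma> :: "'a \<Rightarrow> nat" and s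
    using finite_ground by (simp add: lookup_sum lookup_single when_def sum.If_cases Int_def)
  have c: "Poly_Mapping.lookup (\<Prod>p\<in>A. var (\<sigma> p)) \<alpha> =
      (if \<forall>s. card {x \<in> A. \<sigma> x = s} = Poly_Mapping.lookup \<alpha> s then 1 else 0)" for \<sigma>
    unfolding prod_var lookup_single when_def by (simp only: poly_mapping_eq_iff fun_eq_iff lk)
  show ?thesis unfolding K_def c by (auto intro!: arg_cong[where f = card])
qed

text \<open>Fibre sizes, which an exponent vector records, are successive differences of sublevel
  sizes; monotonicity of \<open>\<rho>\<close> keeps these differences of natural numbers from being
  cut off at 0.\<close>

lemma card_le_iff_card_eq:
  assumes \<sigma>: "\<sigma> \<in> A \<rightarrow>\<^sub>E {1::nat..}" and \<rho>: "\<rho> 0 = 0" "\<And>s. s < t \<Longrightarrow> \<rho> s \<le> \<rho> (Suc s)"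
    "\<rho> t = card A"
  shows "(\<forall>s. card {x \<in> A. \<sigma> x = s} = (if 1 \<le> s \<and> s \<le> t then \<rho> s - \<rho> (s - 1) else 0)) \<longleftrightarrow>
         \<sigma> \<in> A \<rightarrow>\<^sub>E {1..t} \<and> (\<forall>s<t. card {x \<in> A. \<sigma> x \<le> s} = \<rho> s)"
    (is "?lhs \<longleftrightarrow> ?rhs")
proof
  have split: "card {x \<in> A. \<sigma> x \<le> Suc s} = card {x \<in> A. \<sigma> x \<le> s} + card {x \<in> A. \<sigma> x = Suc s}" for s
  proof -
    have "{x \<in> A. \<sigma> x \<le> Suc s} = {x \<in> A. \<sigma> x \<le> s} \<union> {x \<in> A. \<sigma> x = Suc s}" by auto
    then show ?thesis using finite_ground by (simp, subst card_Un_disjoint) auto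
  qed
  have "{x \<in> A. \<sigma> x \<le> 0} = {}" using PiE_mem[OF \<sigma>] by force
  then have zero: "card {x \<in> A. \<sigma> x \<le> 0} = 0" by (simp only: card.empty)
  {
    assume l: ?lhs
    have "\<sigma> x \<le> t" if "x \<in> A" for x
    proof (rule ccontr)
      assume "\<not> \<sigma> x \<le> t"
      then have "card {y \<in> A. \<sigma> y = \<sigma> x} = 0" using l by simp
      then show False using finite_ground that by auto
    qed
    then have "\<sigma> \<in> A \<rightarrow>\<^sub>E {1..t}" using \<sigma> by (auto simp: PiE_iff)
    moreover have "card {x \<in> A. \<sigma> x \<le> s} = \<rho> s" if "s \<le> t" for s
      using that
    proof (induction s)
      case 0
      then show ?case using zero \<rho>(1) by simp
    next
      case (Suc s)
      have "card {x \<in> A. \<sigma> x = Suc s} = \<rho> (Suc s) - \<rho> s" using l Suc.prems by simp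
      then show ?case using Suc \<rho>(2)[of s] split[of s] by simp
    qed
    ultimately show ?rhs by simp
  }
  {
    assume rr: ?rhs
    then have "{x \<in> A. \<sigma> x \<le> t} = A" by auto
    then have le: "card {x \<in> A. \<sigma> x \<le> s} = \<rho> s" if "s \<le> t" for s
      using that rr \<rho>(3) by (cases "s = t") auto
    show ?lhs
    proof
      fix s
      show "card {x \<in> A. \<sigma> x = s} = (if 1 \<le> s \<and> s \<le> t then \<rho> s - \<rho> (s - 1) else 0)"
      proof (cases "1 \<le> s \<and> s \<le> t")
        case True
        then obtain s' where "s = Suc s'" by (cases s) auto
        then show ?thesis using True le[of s'] le[of s] split[of s'] by simp
      next
        case False
        then have "{x \<in> A. \<sigma> x = s} = {}" using rr by force
        then show ?thesis unfolding if_not_P[OF False] by (simp only: card.empty)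
      qed
    qed
  }
qed

lemma K_eq_chain_count:
  assumes \<rho>: "\<rho> 0 = 0" "\<And>s. s < t \<Longrightarrow> \<rho> s \<le> \<rho> (Suc s)" "\<rho> t = card A"
  shows "K A r (\<Sum>s\<in>{1..t}. Poly_Mapping.single s (\<rho> s - \<rho> (s - 1))) = int (chain_count t \<rho> A)"
proof -
  define \<alpha> where "\<alpha> = (\<Sum>s\<in>{1..t}. Poly_Mapping.single s (\<rho> s - \<rho> (s - 1)))"
  have \<alpha>: "Poly_Mapping.lookup \<alpha> s = (if 1 \<le> s \<and> s \<le> t then \<rho> s - \<rho> (s - 1) else 0)" for s
    unfolding \<alpha>_def by (simp add: lookup_sum lookup_single when_def)
  have "{\<sigma> \<in> P_partitions A r. \<forall>s. card {x \<in> A. \<sigma> x = s} = Poly_Mapping.lookup \<alpha> s} =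
      level_maps t \<rho> A" (is "?X = ?Y")
  proof (intro equalityI subsetI)
    fix \<sigma> assume s: "\<sigma> \<in> ?X"
    then have "\<sigma> \<in> A \<rightarrow>\<^sub>E {1..}" unfolding P_partitions_def by blast
    from card_le_iff_card_eq[OF this \<rho>] s show "\<sigma> \<in> ?Y"
      unfolding \<alpha> level_maps_def P_partitions_def by blast
  next
    fix \<sigma> assume s: "\<sigma> \<in> ?Y"
    then have "\<sigma> \<in> A \<rightarrow>\<^sub>E {1..t}" unfolding level_maps_def by blast
    then have "\<sigma> \<in> A \<rightarrow>\<^sub>E {1..}" by (auto simp: PiE_iff)
    from card_le_iff_card_eq[OF this \<rho>] this s show "\<sigma> \<in> ?X"
      unfolding \<alpha> level_maps_def P_partitions_def using rel_in by blast
  qed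
  then show ?thesis
    using card_level_maps[OF ideal_ground, of t \<rho>] K_eq_card[of \<alpha>] unfolding \<alpha>_def by simp
qed

text \<open>Only the map with constant value 1 has a power of the first variable as its monomial, so
  this coefficient reveals the number of elements.\<close>

lemma K_constant: "K A r (Poly_Mapping.single 1 m) = (if m = card A then 1 else 0)"
proof (cases "m = card A")
  case True
  have "K A r (\<Sum>s\<in>{1..1}. Poly_Mapping.single s (of_bool (s \<noteq> 0) * card A - of_bool (s - 1 \<noteq> 0) * card A)) =
      int (chain_count 1 (\<lambda>s. of_bool (s \<noteq> 0) * card A) A)"
    by (rule K_eq_chain_count) auto
  moreover have "{J. J = {} \<and> J \<subseteq> A} = {{}}" by auto
  ultimately show ?thesis using True by (simp add: ideals_zero)
next
  case False
  have "\<sigma> \<notin> {\<sigma> \<in> P_partitions A r. \<forall>s. card {x \<in> A. \<sigma> x = s} =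
      Poly_Mapping.lookup (Poly_Mapping.single 1 m) s}" for \<sigma>
  proof
    assume s: "\<sigma> \<in> {\<sigma> \<in> P_partitions A r. \<forall>s. card {x \<in> A. \<sigma> x = s} =
      Poly_Mapping.lookup (Poly_Mapping.single 1 m) s}"
    have "\<sigma> x = 1" if "x \<in> A" for x
    proof (rule ccontr)
      assume "\<sigma> x \<noteq> 1"
      then have "card {y \<in> A. \<sigma> y = \<sigma> x} = 0" using s by (simp add: lookup_single when_def)
      then show False using finite_ground that by auto
    qed
    then have "{x \<in> A. \<sigma> x = 1} = A" by blast
    moreover have "card {x \<in> A. \<sigma> x = 1} = m" using s by (simp add: lookup_single)
    ultimately show False using False by simp
  qed
  then have "{\<sigma> \<in> P_partitions A r. \<forall>s. card {x \<in> A. \<sigma> x = s} =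
      Poly_Mapping.lookup (Poly_Mapping.single 1 m) s} = {}" by blast
  then show ?thesis using False unfolding K_eq_card by (simp only: card.empty) simp
qed

lemma chain_count_cong:
  "(\<And>s. s < t \<Longrightarrow> \<rho> s = \<rho>' s) \<Longrightarrow> chain_count t \<rho> I = chain_count t \<rho>' I"
  by (induction t arbitrary: I) (auto intro!: sum.cong)

end

lemma card_eq_if_K_eq:
  assumes "fin_poset A r" "fin_poset B s" "K A r = K B s"
  shows "card A = card B"
proof -
  interpret P: fin_poset A r by fact
  interpret Q: fin_poset B s by fact
  have "K B s (Poly_Mapping.single 1 (card A)) = 1"
    unfolding assms(3)[symmetric] by (simp only: P.K_constant if_True refl)
  then show ?thesis unfolding Q.K_constant by (simp split: if_splits)
qed

lemma chain_count_eq_if_K_eq: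
  assumes "fin_poset A r" "fin_poset B s" "K A r = K B s"
    and \<rho>: "\<rho> 0 = 0" "\<And>u. Suc u < t \<Longrightarrow> \<rho> u \<le> \<rho> (Suc u)" "\<rho> (t - 1) \<le> card A" "0 < t"
  shows "fin_poset.chain_count A r t \<rho> A = fin_poset.chain_count B s t \<rho> B"
proof -
  interpret P: fin_poset A r by fact
  interpret Q: fin_poset B s by fact
  note cards = card_eq_if_K_eq[OF assms(1-3)]
  \<comment> \<open>\<open>chain_count\<close> depends only on the entries below \<open>t\<close>,
    whereas the exponent vector must have total degree \<open>card A\<close>; fixing the entry at
    \<open>t\<close> in this way meets both demands.\<close>
  let ?\<rho> = "\<rho>(t := card A)"
  have mono: "?\<rho> u \<le> ?\<rho> (Suc u)" if "u < t" for u
    using \<rho> that by (auto simp: less_Suc_eq)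
  have 0: "?\<rho> 0 = 0" using \<rho>(1,4) by simp
  have "int (P.chain_count t ?\<rho> A) = int (Q.chain_count t ?\<rho> B)"
    using P.K_eq_chain_count[of ?\<rho> t] Q.K_eq_chain_count[of ?\<rho> t] 0 mono assms(3) cards by simp
  moreover have "P.chain_count t ?\<rho> A = P.chain_count t \<rho> A" by (rule P.chain_count_cong) simp
  moreover have "Q.chain_count t ?\<rho> B = Q.chain_count t \<rho> B" by (rule Q.chain_count_cong) simp
  ultimately show ?thesis by simp
qed

section \<open>Width two\<close>

text \<open>The leading 0 accounts for the empty ideal at which \<open>chain_count\<close> starts;
  from index 1 on the sizes are consecutive, which makes the chains saturated. In
  \<open>skip_seq\<close> they increase by two.\<close>

definition rank_seq :: "nat \<Rightarrow> nat \<Rightarrow> nat" where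
  "rank_seq i = case_nat 0 (\<lambda>s. i + s)"

definition skip_seq :: "nat \<Rightarrow> nat \<Rightarrow> nat" where
  "skip_seq i = case_nat 0 (\<lambda>s. i + 2 * s)"

lemma le_choose_two: "m \<le> (m choose 2) + 1"
proof (cases "m \<ge> 2")
  case True
  then obtain d where "m = d + 2" by (metis add.commute le_Suc_ex)
  then show ?thesis by (simp add: numeral_2_eq_2)
qed simp

lemma le_choose_two_eq: "m \<ge> 1 \<Longrightarrow> m = (m choose 2) + 1 \<longleftrightarrow> m \<le> 2"
proof (cases "m \<ge> 3")
  case True
  then obtain d where "m = d + 3" by (metis add.commute le_Suc_ex)
  then show ?thesis by (simp add: numeral_2_eq_2 numeral_3_eq_3)
next
  case False
  assume "m \<ge> 1"
  with False have "m = 1 \<or> m = 2" by linarith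
  then show ?thesis by auto
qed

section \<open>Saturated chains of ideals and the recognition of width two\<close>

context fin_poset
begin

text \<open>Meant for \<open>J\<close> of size \<open>i + s\<close>: the entries of
  \<open>rank_seq i\<close> supply the empty ideal and the ranks from \<open>i\<close> to
  \<open>i + s - 1\<close>, and \<open>J\<close> closes the saturated chain.\<close>

definition path_count :: "nat \<Rightarrow> nat \<Rightarrow> 'a set \<Rightarrow> nat" where
  "path_count i s = chain_count (Suc s) (rank_seq i)"

definition path_total :: "nat \<Rightarrow> nat \<Rightarrow> nat" where
  "path_total i s = chain_count (Suc (Suc s)) (rank_seq i) A"

lemma path_count_0: "path_count i 0 J = 1"
proof -
  have "{I. I = {} \<and> I \<subseteq> J} = {{}}" by auto
  then show ?thesis by (simp add: path_count_def rank_seq_def ideals_zero)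
qed

lemma path_count_Suc:
  "path_count i (Suc s) J = (\<Sum>I | I \<in> ideals (i + s) \<and> I \<subseteq> J. path_count i s I)"
  unfolding path_count_def by (subst chain_count.simps(2)) (simp add: rank_seq_def)

lemma ideals_below_ground: "{I. I \<in> ideals k \<and> I \<subseteq> A} = ideals k"
  unfolding ideals_def using ideal_subset by blast

lemma path_total_eq: "path_total i s = (\<Sum>I\<in>ideals (i + s). path_count i s I)"
  using path_count_Suc[of i s A] unfolding path_total_def path_count_def ideals_below_ground .

lemma skip_total_eq:
  "chain_count 3 (skip_seq i) A = (\<Sum>J\<in>ideals (i + 2). card {I \<in> ideals i. I \<subseteq> J})"
proof -
  have "{I. I = {} \<and> I \<subseteq> J} = {{}}" for J :: "'a set" by auto
  then have "chain_count (Suc (Suc 0)) (skip_seq i) J = card {I \<in> ideals i. I \<subseteq> J}" for J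
    by (simp add: skip_seq_def ideals_zero)
  then show ?thesis
    unfolding numeral_3_eq_3
    by (subst chain_count.simps(2)) (simp add: skip_seq_def ideals_below_ground)
qed

lemma path_count_1:
  assumes "J \<in> ideals (Suc i)"
  shows "path_count i 1 J = card (maxs J)"
  using sum_lower_covers[OF assms, of "path_count i 0"] path_count_Suc[of i 0 J]
  by (simp add: path_count_0)

text \<open>A pair of maximal elements of \<open>J\<close> gives an ideal of size \<open>i\<close> with two saturated chains up to
  \<open>J\<close>; every other ideal of size \<open>i\<close> below \<open>J\<close> has one.\<close>

lemma path_count_2:
  assumes J: "J \<in> ideals (Suc (Suc i))"
  shows "path_count i 2 J = card {I \<in> ideals i. I \<subseteq> J} + (card (maxs J) choose 2)"
proof -
  define m where "m = card (maxs J)"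
  \<comment> \<open>The elements that become maximal only once \<open>x\<close> is gone. A saturated
    chain of two steps below \<open>J\<close> is thus an ordered pair of maximal elements of
    \<open>J\<close> or a member of \<open>Sigma (maxs J) V\<close>.\<close>
  define V where "V x = maxs (J - {x}) - maxs J" for x
  have iJ: "ideal J" "card J = Suc (Suc i)" "finite J" using J ideal_finite unfolding ideals_def by auto
  have fm: "finite (maxs J)" using finite_maxs[OF iJ(1)] .
  have lower: "J - {x} \<in> ideals (Suc i)" if "x \<in> maxs J" for x
    using ideal_remove_max[OF iJ(1) that] that maxs_subset[of J] iJ unfolding ideals_def by auto
  have fV: "finite (V x)" for x
    unfolding V_def using iJ(3) maxs_subset[of "J - {x}"] finite_subset by blast
  have split: "card (maxs (J - {x})) = (m - 1) + card (V x)" if x: "x \<in> maxs J" for x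
  proof -
    have "maxs (J - {x}) = (maxs J - {x}) \<union> V x"
      unfolding V_def maxs_def using x by blast
    moreover have "(maxs J - {x}) \<inter> V x = {}" unfolding V_def by blast
    ultimately show ?thesis using fm fV x unfolding m_def by (simp add: card_Un_disjoint)
  qed
  have "path_count i 2 J = (\<Sum>I | I \<in> ideals (i + 1) \<and> I \<subseteq> J. path_count i 1 I)"
    unfolding numeral_2_eq_2 One_nat_def by (rule path_count_Suc)
  also have "\<dots> = (\<Sum>x\<in>maxs J. path_count i 1 (J - {x}))"
    using sum_lower_covers[OF J, of "path_count i 1"] by simp
  also have "\<dots> = (\<Sum>x\<in>maxs J. (m - 1) + card (V x))"
    using path_count_1[OF lower] split by (intro sum.cong) simp_all
  also have "\<dots> = m * (m - 1) + (\<Sum>x\<in>maxs J. card (V x))"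
    by (simp add: sum.distrib m_def)
  finally have 1: "path_count i 2 J = m * (m - 1) + card (Sigma (maxs J) V)"
    using fm fV by simp
  let ?D = "{D. D \<subseteq> maxs J \<and> card D = 2}"
  let ?h = "\<lambda>D. J - D" and ?g = "\<lambda>(x, y). J - {x, y}"
  have Vsub: "x \<in> maxs J \<and> y \<in> J \<and> y \<notin> maxs J \<and> y \<noteq> x" if "(x, y) \<in> Sigma (maxs J) V" for x y
    using that maxs_subset unfolding V_def by blast
  have "{I \<in> ideals i. I \<subseteq> J} = ?h ` ?D \<union> ?g ` Sigma (maxs J) V"
  proof (intro equalityI subsetI)
    fix I assume "I \<in> {I \<in> ideals i. I \<subseteq> J}"
    then have I: "ideal I" "card I = i" "I \<subseteq> J" unfolding ideals_def by auto
    obtain M where M: "M \<in> ideals (Suc i)" "I \<subseteq> M" "M \<subseteq> J"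
      using ideal_between[OF I(1) iJ(1) I(3), of "Suc i"] I iJ by auto
    have "M \<in> (\<lambda>x. J - {x}) ` maxs J"
      unfolding ideals_lower_cover[OF J, symmetric] using M by simp
    then obtain x where x: "x \<in> maxs J" "M = J - {x}" by auto
    have "I \<in> (\<lambda>x. M - {x}) ` maxs M"
      unfolding ideals_lower_cover[OF M(1), symmetric] using M I by (simp add: ideals_def)
    then obtain y where y: "y \<in> maxs M" "I = M - {y}" by auto
    have I_eq: "I = J - {x, y}" using x y by blast
    show "I \<in> ?h ` ?D \<union> ?g ` Sigma (maxs J) V"
    proof (cases "y \<in> maxs J")
      case True
      have "x \<noteq> y" using x y maxs_subset by blast
      then have "{x, y} \<in> ?D" using True x by simp
      then show ?thesis using I_eq by blast
    next
      case False
      then have "(x, y) \<in> Sigma (maxs J) V" using x y unfolding V_def by blast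
      then have "?g (x, y) \<in> ?g ` Sigma (maxs J) V" by (rule imageI)
      then show ?thesis using I_eq by simp
    qed
  next
    fix I
    have "J - {x, y} \<in> {I \<in> ideals i. I \<subseteq> J}"
      if "x \<in> maxs J" "y \<in> maxs (J - {x})" for x y
    proof -
      have "J - {x} - {y} \<in> {I \<in> ideals i. I \<subseteq> J - {x}}"
        unfolding ideals_lower_cover[OF lower[OF that(1)]] using that(2) by (rule imageI)
      moreover have "J - {x} - {y} = J - {x, y}" by blast
      ultimately show ?thesis by auto
    qed
    note below = this
    assume "I \<in> ?h ` ?D \<union> ?g ` Sigma (maxs J) V"
    then show "I \<in> {I \<in> ideals i. I \<subseteq> J}"
    proof
      assume "I \<in> ?h ` ?D"
      then obtain D where D: "D \<subseteq> maxs J" "card D = 2" "I = J - D" by blast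
      then obtain x y where xy: "D = {x, y}" "x \<noteq> y" by (meson card_2_iff)
      then have "y \<in> maxs (J - {x})" using D(1) unfolding maxs_def by blast
      then show ?thesis using below[of x y] D xy by simp
    next
      assume "I \<in> ?g ` Sigma (maxs J) V"
      then obtain x y where "x \<in> maxs J" "y \<in> V x" "I = J - {x, y}" by auto
      then show ?thesis using below[of x y] unfolding V_def by simp
    qed
  qed
  moreover have "?h ` ?D \<inter> ?g ` Sigma (maxs J) V = {}"
  proof -
    have False if D: "D \<subseteq> maxs J" and p: "(x, y) \<in> Sigma (maxs J) V" and e: "J - D = J - {x, y}"
      for D x y
    proof -
      have "y \<in> D" using e Vsub[OF p] by blast
      then show False using D Vsub[OF p] by blast
    qed
    then show ?thesis by auto
  qed
  moreover have "card (?h ` ?D) = m choose 2"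
  proof -
    have "inj_on ?h ?D"
    proof (rule inj_onI)
      fix D E assume "D \<in> ?D" "E \<in> ?D" and e: "J - D = J - E"
      then have "D \<subseteq> J" "E \<subseteq> J" using maxs_subset by blast+
      with e show "D = E" by blast
    qed
    then show ?thesis using n_subsets[OF fm, of 2] by (simp add: card_image m_def)
  qed
  moreover have "card (?g ` Sigma (maxs J) V) = card (Sigma (maxs J) V)"
  proof (rule card_image, rule inj_onI)
    fix p q assume pq: "p \<in> Sigma (maxs J) V" "q \<in> Sigma (maxs J) V" and e: "?g p = ?g q"
    obtain x y x' y' where xy: "p = (x, y)" "q = (x', y')" by (metis surj_pair)
    have "{x, y} = {x', y'}" using e Vsub[of x y] Vsub[of x' y'] pq maxs_subset[of J] unfolding xy by auto
    then show "p = q" using Vsub[of x y] Vsub[of x' y'] pq unfolding xy by (metis doubleton_eq_iff)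
  qed
  moreover have "finite (?h ` ?D)" "finite (?g ` Sigma (maxs J) V)"
    using fm fV by auto
  ultimately have 2: "card {I \<in> ideals i. I \<subseteq> J} = (m choose 2) + card (Sigma (maxs J) V)"
    by (simp only: card_Un_disjoint)
  \<comment> \<open>Each pair of maximal elements is counted twice among the chains and once among
    the ideals, which leaves one summand \<open>m choose 2\<close>.\<close>
  have "even (m * (m - 1))" by (cases m) auto
  then have "m * (m - 1) = 2 * (m choose 2)" unfolding choose_two by simp
  with 1 2 show ?thesis unfolding m_def by simp
qed

text \<open>As \<open>m \<le> (m choose 2) + 1\<close>, with equality for \<open>m \<in> {1, 2}\<close> only, summing this over all ideals of
  one rank detects from the chain counts whether \<open>card (maxs J) \<le> 2\<close> throughout that rank.\<close>

lemma maxs_le_two_iff: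
  "(\<forall>J\<in>ideals (k + 2). card (maxs J) \<le> 2) \<longleftrightarrow>
   path_total k 2 + path_total (k + 2) 0 = chain_count 3 (skip_seq k) A + path_total (k + 1) 1"
proof -
  let ?S = "ideals (k + 2)"
  have a: "path_total k 2 = chain_count 3 (skip_seq k) A + (\<Sum>J\<in>?S. card (maxs J) choose 2)"
    unfolding path_total_eq skip_total_eq sum.distrib[symmetric]
    by (rule sum.cong) (simp_all add: path_count_2)
  have b: "path_total (k + 2) 0 = (\<Sum>J\<in>?S. 1)"
    unfolding path_total_eq path_count_0 by simp
  have c: "path_total (k + 1) 1 = (\<Sum>J\<in>?S. card (maxs J))"
    unfolding path_total_eq using path_count_1[of _ "k + 1"] by simp
  have pos: "card (maxs J) \<ge> 1" if "J \<in> ?S" for J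
  proof -
    have "ideal J" "J \<noteq> {}" using that unfolding ideals_def by auto
    then show ?thesis using maxs_nonempty[of J] finite_maxs[of J] by (simp add: Suc_le_eq card_gt_0_iff)
  qed
  have "path_total k 2 + path_total (k + 2) 0 = chain_count 3 (skip_seq k) A + path_total (k + 1) 1
      \<longleftrightarrow> (\<Sum>J\<in>?S. (card (maxs J) choose 2) + 1) = (\<Sum>J\<in>?S. card (maxs J))"
    unfolding a b c sum.distrib by linarith
  also have "\<dots> \<longleftrightarrow> (\<forall>J\<in>?S. card (maxs J) = (card (maxs J) choose 2) + 1)"
  proof
    assume e: "(\<Sum>J\<in>?S. (card (maxs J) choose 2) + 1) = (\<Sum>J\<in>?S. card (maxs J))"
    show "\<forall>J\<in>?S. card (maxs J) = (card (maxs J) choose 2) + 1"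
    proof
      fix J assume "J \<in> ?S"
      then show "card (maxs J) = (card (maxs J) choose 2) + 1"
        using sum_mono_inv[OF e[symmetric] le_choose_two _ finite_ideals] by blast
    qed
  next
    assume e: "\<forall>J\<in>?S. card (maxs J) = (card (maxs J) choose 2) + 1"
    show "(\<Sum>J\<in>?S. (card (maxs J) choose 2) + 1) = (\<Sum>J\<in>?S. card (maxs J))"
      by (rule sum.cong[OF refl]) (use e in force)
  qed
  also have "\<dots> \<longleftrightarrow> (\<forall>J\<in>?S. card (maxs J) \<le> 2)"
    using pos le_choose_two_eq by blast
  finally show ?thesis by blast
qed

lemma antichain_maxs: "ideal J \<Longrightarrow> antichain A r (maxs J)"
  unfolding antichain_def maxs_def using ideal_subset by blast

text \<open>The maximal elements of an ideal form an antichain, and every antichain consists of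
  maximal elements of the ideal it generates. Ideals with fewer than two elements satisfy the bound
  anyway, hence the offset 2.\<close>

lemma antichain_le_two_iff:
  "(\<forall>S. antichain A r S \<longrightarrow> card S \<le> 2) \<longleftrightarrow> (\<forall>k. \<forall>J\<in>ideals (k + 2). card (maxs J) \<le> 2)"
proof (intro iffI allI ballI impI)
  fix k J assume "\<forall>S. antichain A r S \<longrightarrow> card S \<le> 2" "J \<in> ideals (k + 2)"
  then show "card (maxs J) \<le> 2" using antichain_maxs unfolding ideals_def by blast
next
  fix S assume m: "\<forall>k. \<forall>J\<in>ideals (k + 2). card (maxs J) \<le> 2" and S: "antichain A r S"
  let ?J = "\<Union>x\<in>S. down x"
  have J: "ideal ?J" using ideal_down unfolding ideal_def by blast
  have sub: "S \<subseteq> maxs ?J"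
  proof
    fix x assume x: "x \<in> S"
    then have "x \<in> ?J" using down_self S unfolding antichain_def by blast
    moreover have "y = x" if y: "y \<in> ?J" "(x, y) \<in> r" for y
    proof -
      obtain z where z: "z \<in> S" "(y, z) \<in> r" using y(1) unfolding down_def by blast
      then have "(x, z) \<in> r" using trans_rel y(2) by blast
      then have "x = z" using S x z(1) unfolding antichain_def by blast
      then show ?thesis using antisym_rel y(2) z(2) by blast
    qed
    ultimately show "x \<in> maxs ?J" unfolding maxs_def by blast
  qed
  show "card S \<le> 2"
  proof (rule ccontr)
    assume "\<not> card S \<le> 2"
    moreover have "card S \<le> card (maxs ?J)" using sub finite_maxs[OF J] by (rule card_mono[rotated])
    moreover have "card (maxs ?J) \<le> card ?J" using maxs_subset ideal_finite[OF J] by (intro card_mono)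
    ultimately have "card ?J \<ge> 2" "card (maxs ?J) > 2" by auto
    moreover from this have "?J \<in> ideals (card ?J - 2 + 2)" using J unfolding ideals_def by simp
    ultimately show False using m by fastforce
  qed
qed

lemma poset_width_le_iff: "poset_width A r \<le> k \<longleftrightarrow> (\<forall>S. antichain A r S \<longrightarrow> card S \<le> k)"
proof -
  have "finite {S. antichain A r S}"
    using finite_subset[of _ "Pow A"] finite_ground unfolding antichain_def by fast
  moreover have "antichain A r {}" unfolding antichain_def by blast
  ultimately show ?thesis unfolding poset_width_def by (subst Max_le_iff) auto
qed

section \<open>Partition of a poset of width two into two chains\<close>

lemma chain_insert_top:
  assumes "C \<in> Chains r" "x \<in> A" "\<And>y. y \<in> C \<Longrightarrow> (y, x) \<in> r"
  shows "insert x C \<in> Chains r"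
  using assms refl_rel unfolding Chains_def by blast

lemma chain_append:
  assumes "C \<in> Chains r" "D \<in> Chains r" "\<And>x y. x \<in> C \<Longrightarrow> y \<in> D \<Longrightarrow> (x, y) \<in> r"
  shows "C \<union> D \<in> Chains r"
  using assms unfolding Chains_def by blast

lemma chain_subset: "C \<in> Chains r \<Longrightarrow> D \<subseteq> C \<Longrightarrow> D \<in> Chains r"
  unfolding Chains_def by blast

text \<open>Induction by removing a maximal element \<open>x\<close>. The elements not below
  \<open>x\<close> form a chain, as two incomparable ones among them would form an antichain of size
  three with \<open>x\<close>.\<close>

lemma dilworth_width_two:
  assumes w: "\<And>S. antichain A r S \<Longrightarrow> card S \<le> 2" and "ideal J"
  shows "\<exists>C\<^sub>1 C\<^sub>2. C\<^sub>1 \<in> Chains r \<and> C\<^sub>2 \<in> Chains r \<and> C\<^sub>1 \<union> C\<^sub>2 = J \<and> C\<^sub>1 \<inter> C\<^sub>2 = {}"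
  using assms(2)
proof (induction "card J" arbitrary: J)
  case 0
  then have "J = {}" using ideal_finite by auto
  then show ?case unfolding Chains_def by blast
next
  case (Suc n)
  then have "maxs J \<noteq> {}" using maxs_nonempty by force
  then obtain x where x: "x \<in> maxs J" by blast
  then have xJ: "x \<in> J" "x \<in> A" using maxs_subset ideal_subset[OF Suc.prems] by blast+
  have "ideal (J - {x})" "card (J - {x}) = n"
    using ideal_remove_max[OF Suc.prems x] xJ(1) Suc.hyps(2) by auto
  from Suc.hyps(1)[OF this(2)[symmetric] this(1)]
  obtain C D where CD: "C \<in> Chains r" "D \<in> Chains r" "C \<union> D = J - {x}" "C \<inter> D = {}" by blast
  define N where "N = {y \<in> J - {x}. (y, x) \<notin> r}"
  have x_not: "(x, y) \<notin> r" if "y \<in> N" for y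
    using that x unfolding N_def maxs_def by blast
  have N: "N \<in> Chains r"
    unfolding Chains_def
  proof (intro CollectI ballI, rule ccontr)
    fix y z assume yz: "y \<in> N" "z \<in> N" and n: "\<not> ((y, z) \<in> r \<or> (z, y) \<in> r)"
    have A: "y \<in> A" "z \<in> A" using yz ideal_subset[OF Suc.prems] unfolding N_def by blast+
    have ne: "y \<noteq> z" "x \<noteq> y" "x \<noteq> z" using n refl_rel A yz unfolding N_def by blast+
    have "antichain A r {x, y, z}"
      unfolding antichain_def using A xJ yz n x_not N_def by auto
    from w[OF this] show False using ne by simp
  qed
  \<comment> \<open>The chain \<open>N\<close> of elements incomparable to \<open>x\<close> is put on top of the chain containing its least
    element, which frees the other chain for \<open>x\<close>.\<close>
  have key: "\<exists>C\<^sub>1 C\<^sub>2. C\<^sub>1 \<in> Chains r \<and> C\<^sub>2 \<in> Chains r \<and> C\<^sub>1 \<union> C\<^sub>2 = J \<and> C\<^sub>1 \<inter> C\<^sub>2 = {}"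
    if E: "E \<in> Chains r" "F \<in> Chains r" "E \<union> F = J - {x}" "E \<inter> F = {}"
      and m: "m \<in> N" "m \<in> E" "\<And>y. y \<in> N \<Longrightarrow> (m, y) \<in> r" for E F m
  proof (intro exI conjI)
    \<comment> \<open>Here \<open>y\<close> is below \<open>x\<close> and \<open>m\<close> is not,
      so \<open>y\<close> cannot be above \<open>m\<close>; both lie in the chain
      \<open>E\<close>.\<close>
    have below: "(y, m) \<in> r" if "y \<in> E - N" for y
    proof -
      have "(y, x) \<in> r" using that E(3) unfolding N_def by blast
      moreover have "(m, x) \<notin> r" using m(1) unfolding N_def by blast
      ultimately have "(m, y) \<notin> r" using trans_rel by blast
      then show ?thesis using E(1) m(2) that unfolding Chains_def by blast
    qed
    show "(E - N) \<union> N \<in> Chains r"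
    proof (rule chain_append)
      show "E - N \<in> Chains r" using E(1) by (rule chain_subset) blast
      show "(y, z) \<in> r" if "y \<in> E - N" "z \<in> N" for y z
        using below[OF that(1)] m(3)[OF that(2)] by (rule trans_rel)
    qed (rule N)
    show "insert x (F - N) \<in> Chains r"
    proof (rule chain_insert_top)
      show "F - N \<in> Chains r" using E(2) by (rule chain_subset) blast
      show "(y, x) \<in> r" if "y \<in> F - N" for y using that E(3) unfolding N_def by blast
    qed (rule xJ(2))
    show "(E - N) \<union> N \<union> insert x (F - N) = J" using E(3) xJ unfolding N_def by blast
    show "((E - N) \<union> N) \<inter> insert x (F - N) = {}" using E(3,4) unfolding N_def by blast
  qed
  show ?case
  proof (cases "N = {}")
    case True
    then have "insert x C \<in> Chains r"
      using chain_insert_top[OF CD(1) xJ(2)] CD(3) unfolding N_def by blast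
    moreover have "insert x C \<union> D = J" "insert x C \<inter> D = {}" using CD xJ by blast+
    ultimately show ?thesis using CD(2) by blast
  next
    case False
    have "finite N" "N \<subseteq> A"
      using ideal_finite[OF Suc.prems] ideal_subset[OF Suc.prems] unfolding N_def by auto
    from min_exists[OF this(1) False this(2)]
    obtain m where m: "m \<in> N" "\<forall>y\<in>N. (y, m) \<in> r \<longrightarrow> y = m" by blast
    have min: "(m, y) \<in> r" if "y \<in> N" for y
    proof -
      have "(m, y) \<in> r \<or> (y, m) \<in> r" using N m(1) that unfolding Chains_def by blast
      then show ?thesis using m that by metis
    qed
    have "m \<in> C \<or> m \<in> D" using m(1) CD(3) unfolding N_def by blast
    then show ?thesis
    proof
      assume "m \<in> C"
      from key[OF CD m(1) this min] show ?thesis by blast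
    next
      assume "m \<in> D"
      moreover have "D \<union> C = J - {x}" "D \<inter> C = {}" using CD by auto
      ultimately show ?thesis using key[OF CD(2,1) _ _ m(1) _ min] by blast
    qed
  qed
qed

end

section \<open>Lattice paths\<close>

text \<open>The number of lattice walks that start anywhere in \<open>X i\<close>, keep their
  position or raise it by one at each step, stay inside \<open>X\<close>, and reach \<open>a\<close>
  after \<open>s\<close> steps. It is an integer because differences of such numbers are
  studied.\<close>

primrec walk :: "(nat \<Rightarrow> int set) \<Rightarrow> nat \<Rightarrow> nat \<Rightarrow> int \<Rightarrow> int" where
  "walk X i 0 a = of_bool (a \<in> X i)"
| "walk X i (Suc s) a = (if a \<in> X (i + Suc s) then walk X i s a + walk X i s (a - 1) else 0)"

lemma walk_outside: "a \<notin> X (i + s) \<Longrightarrow> walk X i s a = 0"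
  by (cases s) simp_all

lemma walk_cong: "(\<And>t. i \<le> t \<Longrightarrow> t \<le> i + s \<Longrightarrow> X t = Y t) \<Longrightarrow> walk X i s a = walk Y i s a"
  by (induction s arbitrary: a) auto

declare walk.simps(2) [simp del]

definition region :: "nat \<Rightarrow> (nat \<Rightarrow> int set) \<Rightarrow> (nat \<Rightarrow> int) \<Rightarrow> (nat \<Rightarrow> int) \<Rightarrow> bool" where
  "region n X l u \<longleftrightarrow> l 0 = 0 \<and> u 0 = 0 \<and> (\<forall>t\<le>n. l t \<le> u t \<and> X t = {l t..u t}) \<and>
     (\<forall>t<n. l (Suc t) - l t \<in> {0, 1} \<and> u (Suc t) - u t \<in> {0, 1})"

lemma regionD:
  assumes "region n X l u"
  shows "l 0 = 0" "u 0 = 0" "t \<le> n \<Longrightarrow> l t \<le> u t" "t \<le> n \<Longrightarrow> X t = {l t..u t}"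
    "t < n \<Longrightarrow> l (Suc t) = l t \<or> l (Suc t) = l t + 1"
    "t < n \<Longrightarrow> u (Suc t) = u t \<or> u (Suc t) = u t + 1"
  using assms unfolding region_def by (auto simp: algebra_simps)

text \<open>The difference of the numbers of walks ending at mirror-image points of the symmetric part is
  an odd function of the position, of constant sign on either side of the centre.\<close>

lemma walk_reflect:
  assumes R: "region n X l u" and "i < j" "j \<le> n"
    and wide: "\<And>t. i \<le> t \<Longrightarrow> t \<le> j \<Longrightarrow> l t < u t"
    and shift: "l (Suc i) = l i + \<delta>" "u (Suc i) = u i + \<delta>" "\<delta> = 0 \<or> \<delta> = 1"
    and sym: "\<And>t. i < t \<Longrightarrow> t < j \<Longrightarrow> l (Suc t) + u (Suc t) = l t + u t + 1"
  shows "walk X i (j - i) (l j) \<noteq> walk X i (j - i) (u j)"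
proof -
  \<comment> \<open>After the flat step the sum of the two endpoints grows by one per rank, so the
    reflection at rank \<open>t\<close> sends \<open>a\<close> to \<open>c + int t - a\<close> with
    \<open>c\<close> constant.\<close>
  define c where "c = l (Suc i) + u (Suc i) - int (Suc i)"
  \<comment> \<open>Right after the flat step every point is reached by two walks, except one end
    that is reached by a single one: the lower end if \<open>\<delta> = 0\<close>, the upper end if
    \<open>\<delta> = 1\<close>. The sign \<open>\<sigma>\<close> merges both cases.\<close>
  define \<sigma> where "\<sigma> = 2 * \<delta> - 1"
  have X: "X t = {l t..u t}" if "t \<le> j" for t using regionD(4)[OF R] that assms(3) by simp
  have ctr: "l t + u t = c + int t" if "i < t" "t \<le> j" for t
    using that
  proof (induction t)
    case (Suc t)
    show ?case
    proof (cases "i = t")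
      case False
      then show ?thesis using Suc sym[of t] by simp
    qed (simp add: c_def)
  qed simp
  have "(\<forall>a. c + int (i + Suc s) \<le> 2 * a \<longrightarrow>
          0 \<le> \<sigma> * (walk X i (Suc s) (c + int (i + Suc s) - a) - walk X i (Suc s) a)) \<and>
        0 < \<sigma> * (walk X i (Suc s) (l (i + Suc s)) - walk X i (Suc s) (u (i + Suc s)))"
    if "i + Suc s \<le> j" for s
    using that
  proof (induction s)
    case 0
    have lu: "l i < u i" using wide[of i] assms(2) by simp
    have X0: "X i = {l i..u i}" "X (Suc i) = {l i + \<delta>..u i + \<delta>}"
      using X[of i] X[of "Suc i"] assms(2) shift by auto
    show ?case
      using shift(3) lu unfolding c_def \<sigma>_def by (auto simp: X0 shift(1,2) walk.simps(2))
  next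
    case (Suc s)
    let ?t = "i + Suc s"
    let ?w = "walk X i (Suc s)" and ?v = "walk X i (Suc (Suc s))"
    let ?D = "\<lambda>a. \<sigma> * (?w (c + int ?t - a) - ?w a)"
    have t: "i < ?t" "?t < j" using Suc.prems by auto
    have IH: "0 \<le> ?D a" if "c + int ?t \<le> 2 * a" for a using Suc that by simp
    have IHs: "0 < \<sigma> * (?w (l ?t) - ?w (u ?t))" using Suc by simp
    have c1: "l ?t + u ?t = c + int ?t" and c2: "l (Suc ?t) + u (Suc ?t) = c + int ?t + 1"
      using ctr[of ?t] ctr[of "Suc ?t"] t by auto
    have Xs: "X (Suc ?t) = {l (Suc ?t)..u (Suc ?t)}" using X t by simp
    have refl: "c + int ?t + 1 - a \<in> X (Suc ?t) \<longleftrightarrow> a \<in> X (Suc ?t)" for a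
      unfolding Xs using c2 by auto
    \<comment> \<open>Reflection exchanges the two predecessors of a point, so the signed difference
      obeys the same recursion as the walks.\<close>
    have D: "\<sigma> * (?v (c + int (i + Suc (Suc s)) - a) - ?v a) = ?D a + ?D (a - 1)"
      if "a \<in> X (Suc ?t)" for a
    proof -
      have e1: "c + int (i + Suc (Suc s)) - a = c + int ?t + 1 - a" by simp
      have e2: "?v (c + int ?t + 1 - a) = ?w (c + int ?t - (a - 1)) + ?w (c + int ?t - a)"
        using that refl[of a] by (subst walk.simps(2)) (simp add: algebra_simps)
      have e3: "?v a = ?w a + ?w (a - 1)" using that by (subst walk.simps(2)) simp
      show ?thesis unfolding e1 e2 e3 by (simp only: algebra_simps)
    qed
    have "0 \<le> \<sigma> * (?v (c + int (i + Suc (Suc s)) - a) - ?v a)"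
      if a: "c + int (i + Suc (Suc s)) \<le> 2 * a" for a
    proof (cases "a \<in> X (Suc ?t)")
      case True
      show ?thesis
      \<comment> \<open>At the centre \<open>a\<close> is its own mirror image; beyond it
        \<open>a - 1\<close> still lies in the upper half of the previous rank, so both summands are
        nonnegative.\<close>
      proof (cases "c + int ?t + 1 = 2 * a")
        case True
        then have "c + int (i + Suc (Suc s)) - a = a" by simp
        then show ?thesis by simp
      next
        case False
        then show ?thesis using IH[of a] IH[of "a - 1"] a unfolding D[OF True] by simp
      qed
    next
      case False
      then have "?v a = 0" "?v (c + int ?t + 1 - a) = 0"
        using refl[of a] walk_outside[of _ X i "Suc (Suc s)"] by simp_all
      moreover have "c + int (i + Suc (Suc s)) - a = c + int ?t + 1 - a" by simp
      ultimately show ?thesis by (simp only: diff_self mult_zero_right order_refl)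
    qed
    moreover have "0 < \<sigma> * (?v (l (i + Suc (Suc s))) - ?v (u (i + Suc (Suc s))))"
    proof -
      let ?u = "u (Suc ?t)"
      have lt: "l (Suc ?t) < ?u" using wide[of "Suc ?t"] t by simp
      have "?u \<in> X (Suc ?t)" using lt Xs by simp
      moreover have "l (i + Suc (Suc s)) = c + int (i + Suc (Suc s)) - ?u" using c2 by simp
      moreover have "i + Suc (Suc s) = Suc ?t" by simp
      ultimately have e: "\<sigma> * (?v (l (i + Suc (Suc s))) - ?v (u (i + Suc (Suc s)))) = ?D ?u + ?D (?u - 1)"
        using D[of ?u] by metis
      have "l ?t = c + int ?t - u ?t" using c1 by simp
      then have pos: "0 < ?D (u ?t)" using IHs by simp
      \<comment> \<open>Whichever way the upper end moves, the strictly positive value at the old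
        upper end is one of the two summands.\<close>
      have "?u = u ?t \<or> ?u = u ?t + 1" using regionD(6)[OF R, of ?t] t assms(3) by simp
      then have "0 < ?D ?u + ?D (?u - 1)"
      proof
        assume *: "?u = u ?t"
        have "0 \<le> ?D (?u - 1)" using lt c2 by (intro IH) simp
        then show ?thesis using pos * by simp
      next
        assume *: "?u = u ?t + 1"
        have "0 \<le> ?D ?u" using lt c2 by (intro IH) simp
        then show ?thesis using pos * by simp
      qed
      then show ?thesis unfolding e .
    qed
    ultimately show ?case by blast
  qed
  moreover have "Suc (j - i - 1) = j - i" using assms(2) by simp
  ultimately have "walk X i (j - i) (l j) - walk X i (j - i) (u j) \<noteq> 0"
    using assms(2) by (metis le_add_diff_inverse less_imp_le mult_zero_right less_irrefl order_refl)
  then show ?thesis by simp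
qed

lemma sum_shifted:
  fixes w :: "int \<Rightarrow> int"
  assumes "l \<le> u" "w (l - 1) = 0"
  shows "(\<Sum>a\<in>{l..u}. w (a - 1)) = (\<Sum>a\<in>{l..u}. w a) - w u"
proof -
  have "(\<Sum>a\<in>{l..u}. w (a - 1)) = (\<Sum>a\<in>{l - 1..u - 1}. w a)"
    by (rule sum.reindex_bij_witness[of _ "\<lambda>a. a + 1" "\<lambda>a. a - 1"]) auto
  also have "{l - 1..u - 1} = insert (l - 1) {l..u - 1}" using assms(1) by auto
  also have "(\<Sum>a\<in>insert (l - 1) {l..u - 1}. w a) = (\<Sum>a\<in>{l..u - 1}. w a)" using assms(2) by simp
  also have "{l..u} = insert u {l..u - 1}" using assms(1) by auto
  then have "(\<Sum>a\<in>{l..u - 1}. w a) = (\<Sum>a\<in>{l..u}. w a) - w u" by simp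
  finally show ?thesis .
qed

text \<open>Every walk has two continuations, except at the one end where a continuation leaves the
  new interval: the upward step from \<open>u\<close> if the interval stays, the level step from
  \<open>l\<close> if it moves up.\<close>

lemma walk_total_shift:
  assumes "X (i + s) = {l..u}" "l \<le> u" "X (i + Suc s) = {l + \<delta>..u + \<delta>}" "\<delta> = 0 \<or> \<delta> = 1"
  shows "(\<Sum>a\<in>X (i + Suc s). walk X i (Suc s) a) =
    2 * (\<Sum>a\<in>{l..u}. walk X i s a) - walk X i s (if \<delta> = 0 then u else l)"
proof -
  let ?w = "walk X i s"
  have out: "?w (l - 1) = 0" "?w (u + 1) = 0" using assms(1) by (auto intro!: walk_outside)
  have "(\<Sum>a\<in>X (i + Suc s). walk X i (Suc s) a) = (\<Sum>a\<in>{l + \<delta>..u + \<delta>}. ?w a + ?w (a - 1))"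
    using assms(3) by (simp add: walk.simps(2))
  also have "\<dots> = (\<Sum>a\<in>{l + \<delta>..u + \<delta>}. ?w a) + (\<Sum>a\<in>{l + \<delta>..u + \<delta>}. ?w (a - 1))"
    by (rule sum.distrib)
  also have "\<dots> = 2 * (\<Sum>a\<in>{l..u}. ?w a) - ?w (if \<delta> = 0 then u else l)"
  proof (cases "\<delta> = 0")
    case True
    then show ?thesis using sum_shifted[of l u ?w] out assms(2) by simp
  next
    case False
    then have "\<delta> = 1" using assms(4) by simp
    have "(\<Sum>a\<in>{l + 1..u + 1}. ?w (a - 1)) = (\<Sum>a\<in>{l..u}. ?w a)"
      by (rule sum.reindex_bij_witness[of _ "\<lambda>a. a + 1" "\<lambda>a. a - 1"]) auto
    moreover have "(\<Sum>a\<in>{l + 1..u + 1}. ?w a) = (\<Sum>a\<in>{l..u}. ?w a) - ?w l"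
    proof -
      have "{l..u} = insert l {l + 1..u}" "{l + 1..u + 1} = insert (u + 1) {l + 1..u}"
        using assms(2) by auto
      then show ?thesis using out by simp
    qed
    ultimately show ?thesis using \<open>\<delta> = 1\<close> by simp
  qed
  finally show ?thesis .
qed

lemma reflect_interval: "(\<lambda>a::int. c - a) ` {l..u} = {c - u..c - l}"
  by simp

text \<open>A disagreement at rank \<open>Suc j\<close> consists of two flat steps in opposite
  directions. If no other flat step has occurred since the last one-point rank, the region is
  symmetric from there on and the disagreement is a reflection; otherwise
  \<open>walk_reflect\<close>, applied from the last flat step, contradicts the equality of
  totals.\<close>

lemma regions_agree_step:
  assumes X: "region n X l u" and Y: "region n Y l' u'" and j: "j < n"
    and agree: "\<And>t. t \<le> j \<Longrightarrow> X t = Y t"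
    and total: "\<And>i. i \<le> Suc j \<Longrightarrow>
      (\<Sum>a\<in>X (Suc j). walk X i (Suc j - i) a) = (\<Sum>a\<in>Y (Suc j). walk Y i (Suc j - i) a)"
  shows "X (Suc j) = Y (Suc j) \<or>
    (\<exists>k b. k \<le> j \<and> Y k = {b} \<and>
       (\<forall>t. k \<le> t \<and> t \<le> Suc j \<longrightarrow> X t = (\<lambda>a. (2 * b + int t - int k) - a) ` Y t))"
proof (rule disjCI)
  assume contra: "\<not> (\<exists>k b. k \<le> j \<and> Y k = {b} \<and>
       (\<forall>t. k \<le> t \<and> t \<le> Suc j \<longrightarrow> X t = (\<lambda>a. (2 * b + int t - int k) - a) ` Y t))"
  have lu: "l t = l' t" "u t = u' t" if "t \<le> j" for t
    using agree[OF that] regionD(3,4)[OF X, of t] regionD(3,4)[OF Y, of t] that j by auto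
  have Xj: "X (Suc j) = {l (Suc j)..u (Suc j)}" "Y (Suc j) = {l' (Suc j)..u' (Suc j)}"
    using regionD(4)[OF X] regionD(4)[OF Y] j by auto
  have le: "l (Suc j) \<le> u (Suc j)" "l' (Suc j) \<le> u' (Suc j)"
    using regionD(3)[OF X] regionD(3)[OF Y] j by auto
  \<comment> \<open>Walks of length 0 count the points of the interval.\<close>
  have "(\<Sum>a\<in>X (Suc j). walk X (Suc j) 0 a) = (\<Sum>a\<in>Y (Suc j). walk Y (Suc j) 0 a)"
    using total[of "Suc j"] by simp
  then have width: "u (Suc j) - l (Suc j) = u' (Suc j) - l' (Suc j)"
    using le unfolding Xj by (simp add: Xj)
  note steps = regionD(5,6)[OF X j] regionD(5,6)[OF Y j]
  show "X (Suc j) = Y (Suc j)"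
  proof (rule ccontr)
    assume ne: "X (Suc j) \<noteq> Y (Suc j)"
    then have ne': "l (Suc j) \<noteq> l' (Suc j) \<or> u (Suc j) \<noteq> u' (Suc j)" unfolding Xj by auto
    define \<delta> where "\<delta> = l (Suc j) - l j"
    have \<delta>: "\<delta> = 0 \<or> \<delta> = 1" using steps(1) unfolding \<delta>_def by auto
    have Xs: "l (Suc j) = l j + \<delta>" "u (Suc j) = u j + \<delta>"
      and Ys: "l' (Suc j) = l j + (1 - \<delta>)" "u' (Suc j) = u j + (1 - \<delta>)"
      using steps ne' width lu[of j] unfolding \<delta>_def by auto
    \<comment> \<open>The last one-point rank up to \<open>j\<close>, which exists because rank 0 is
      one. Beyond it the intervals have at least two points, as \<open>walk_reflect\<close>
      requires.\<close>
    define k where "k = Max {t. t \<le> j \<and> l t = u t}"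
    have fin: "finite {t. t \<le> j \<and> l t = u t}" by simp
    have "0 \<in> {t. t \<le> j \<and> l t = u t}" using regionD(1,2)[OF X] by simp
    then have "k \<in> {t. t \<le> j \<and> l t = u t}" unfolding k_def using fin by (intro Max_in) auto
    then have k: "k \<le> j" "l k = u k" by auto
    have wide: "l t < u t" if "k < t" "t \<le> j" for t
    proof -
      have "l t \<noteq> u t"
      proof
        assume "l t = u t"
        then have "t \<le> k" unfolding k_def using that fin by (intro Max_ge) auto
        then show False using that by simp
      qed
      then show ?thesis using regionD(3)[OF X, of t] that j by simp
    qed
    define flats where "flats = {t. k \<le> t \<and> t < j \<and> l (Suc t) - l t = u (Suc t) - u t}"
    have finf: "finite flats" unfolding flats_def by simp
    have nonflat: "l (Suc t) + u (Suc t) = l t + u t + 1" if "k \<le> t" "t < j" "t \<notin> flats" for t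
      using regionD(5,6)[OF X, of t] that j unfolding flats_def by auto
    show False
    proof (cases "flats = {}")
      case True
      have ctr: "l t + u t = 2 * l k + int t - int k" if "k \<le> t" "t \<le> j" for t
        using that
      proof (induction t)
        case 0
        then show ?case using k by simp
      next
        case (Suc t)
        show ?case
        proof (cases "k = Suc t")
          case False
          then show ?thesis using Suc nonflat[of t] True by simp
        qed (use k in simp)
      qed
      have refl: "X t = (\<lambda>a. (2 * l k + int t - int k) - a) ` Y t" if t: "k \<le> t" "t \<le> Suc j" for t
      proof (cases "t = Suc j")
        case True
        have "l j + u j = 2 * l k + int j - int k" using ctr[of j] k by simp
        then show ?thesis unfolding True Xj reflect_interval Xs Ys by simp
      next
        case False
        then have tj: "t \<le> j" using t by simp
        then have "Y t = {l t..u t}" "X t = {l t..u t}" using agree regionD(4)[OF X, of t] j by auto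
        then show ?thesis using ctr[OF t(1) tj] reflect_interval by simp
      qed
      have "Y k = {l k}" using agree[OF k(1)] regionD(4)[OF X, of k] k j by simp
      then show False
        using contra k(1) refl by (elim notE, intro exI[of _ k] exI[of _ "l k"]) simp
    next
      case False
      define i where "i = Max flats"
      have "i \<in> flats" unfolding i_def using finf False by (rule Max_in)
      then have i: "k \<le> i" "i < j" "l (Suc i) - l i = u (Suc i) - u i" unfolding flats_def by auto
      have last: "t \<notin> flats" if "i < t" for t
        using that Max_ge[OF finf, of t] unfolding i_def by auto
      \<comment> \<open>A flat step out of rank \<open>k\<close> would lead to another one-point
        interval, against the choice of \<open>k\<close>.\<close>
      have "k \<noteq> i" using i wide[of "Suc i"] k by force
      then have ki: "k < i" using i by simp
      have "walk X i (j - i) (l j) \<noteq> walk X i (j - i) (u j)"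
      proof (rule walk_reflect[OF X i(2), where \<delta> = "l (Suc i) - l i"])
        show "l t < u t" if "i \<le> t" "t \<le> j" for t using wide that ki by simp
        show "l (Suc t) + u (Suc t) = l t + u t + 1" if "i < t" "t < j" for t
          using nonflat[of t] last[of t] that ki by simp
      qed (use i j regionD(5)[OF X, of i] in auto)
      moreover have "walk X i (j - i) (l j) = walk X i (j - i) (u j)"
      proof -
        define s where "s = j - i"
        have s: "i + s = j" "Suc j - i = Suc s" unfolding s_def using i by auto
        have wXY: "walk X i s a = walk Y i s a" for a
          using agree s by (intro walk_cong) auto
        have Xj0: "X j = {l j..u j}" "l j \<le> u j" using regionD(3,4)[OF X, of j] j by auto
        have tX: "(\<Sum>a\<in>X (i + Suc s). walk X i (Suc s) a) =
            2 * (\<Sum>a\<in>{l j..u j}. walk X i s a) - walk X i s (if \<delta> = 0 then u j else l j)"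
          using Xj0 s \<delta> Xj Xs by (intro walk_total_shift) auto
        have tY: "(\<Sum>a\<in>Y (i + Suc s). walk Y i (Suc s) a) =
            2 * (\<Sum>a\<in>{l j..u j}. walk Y i s a) - walk Y i s (if 1 - \<delta> = 0 then u j else l j)"
          using Xj0 agree[of j] s \<delta> Xj Ys by (intro walk_total_shift) auto
        have "walk X i s (if \<delta> = 0 then u j else l j) = walk X i s (if 1 - \<delta> = 0 then u j else l j)"
          using tX tY total[of i] s i unfolding wXY by simp
        then show ?thesis using \<delta> unfolding s_def by auto
      qed
      ultimately show False by contradiction
    qed
  qed
qed

section \<open>Coordinates of ideals\<close>

context fin_poset
begin

definition coord :: "'a set \<Rightarrow> 'a set \<Rightarrow> int" where
  "coord C I = int (card (I \<inter> C))"

definition coords :: "'a set \<Rightarrow> nat \<Rightarrow> int set" where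
  "coords C t = coord C ` ideals t"

text \<open>For an element of the chain \<open>C\<close> this is its place in the chain, counted
  from 1.\<close>

definition pos :: "'a set \<Rightarrow> 'a \<Rightarrow> nat" where
  "pos C x = card (down x \<inter> C)"

lemma mem_ideal_iff_pos:
  assumes "C \<in> Chains r" "C \<subseteq> A" "x \<in> C" "ideal I"
  shows "x \<in> I \<longleftrightarrow> pos C x \<le> card (I \<inter> C)"
proof
  assume "x \<in> I"
  then show "pos C x \<le> card (I \<inter> C)"
    unfolding pos_def using down_subset[OF assms(4)] ideal_finite[OF assms(4)]
    by (intro card_mono) auto
next
  assume "pos C x \<le> card (I \<inter> C)"
  then have "down x \<inter> C \<subseteq> I \<inter> C"
    unfolding pos_def using chain_card_le[OF ideal_down assms(4,1)] by blast
  then show "x \<in> I" using down_self assms(2,3) by blast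
qed

lemma bij_pos:
  assumes "C \<in> Chains r" "C \<subseteq> A"
  shows "bij_betw (pos C) C {1..card C}"
proof -
  have fin: "finite C" using finite_subset[OF assms(2) finite_ground] .
  have inj: "inj_on (pos C) C"
  proof (rule inj_onI)
    fix x y assume xy: "x \<in> C" "y \<in> C" "pos C x = pos C y"
    have "x \<in> down y" "y \<in> down x"
      using mem_ideal_iff_pos[OF assms xy(1) ideal_down, of y]
        mem_ideal_iff_pos[OF assms xy(2) ideal_down, of x] xy(3) unfolding pos_def by auto
    then show "x = y" using antisym_rel unfolding down_def by blast
  qed
  have sub: "pos C ` C \<subseteq> {1..card C}"
  proof
    fix p assume "p \<in> pos C ` C"
    then obtain x where x: "x \<in> C" "p = pos C x" by blast
    have "x \<in> down x \<inter> C" using x down_self assms(2) by blast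
    then have "card (down x \<inter> C) > 0" using fin card_gt_0_iff by blast
    moreover have "card (down x \<inter> C) \<le> card C" using fin by (intro card_mono) auto
    ultimately show "p \<in> {1..card C}" using x unfolding pos_def by simp
  qed
  have "pos C ` C = {1..card C}"
    using sub card_image[OF inj] by (intro card_subset_eq) auto
  with inj show ?thesis unfolding bij_betw_def by blast
qed

text \<open>If \<open>down y\<close> has at least \<open>k\<close> elements, it contains an ideal of
  size \<open>k\<close>, which must be \<open>I\<close>, so \<open>x\<close> is below
  \<open>y\<close>. If it has fewer, it lies in such an ideal, and \<open>y\<close> would belong to
  \<open>I\<close>.\<close>

lemma ideals_sandwich:
  assumes "ideals k = {I}" "x \<in> I" "y \<in> A" "y \<notin> I"
  shows "(x, y) \<in> r"
proof (rule ccontr)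
  assume n: "(x, y) \<notin> r"
  have I: "I \<in> ideals k" using assms(1) by simp
  have k: "k \<le> card A" using ideals_card_le[OF I] .
  show False
  proof (cases "k \<le> card (down y)")
    case True
    then obtain M where M: "M \<in> ideals k" "M \<subseteq> down y"
      using ideal_between[OF ideal_empty ideal_down] by fastforce
    then have "M = I" using assms(1) by blast
    then show False using M(2) assms(2) n unfolding down_def by blast
  next
    case False
    then obtain M where M: "M \<in> ideals k" "down y \<subseteq> M"
      using ideal_between[OF ideal_down ideal_ground ideal_subset[OF ideal_down], of y k] k by auto
    then have "M = I" using assms(1) by blast
    then show False using M(2) assms(3,4) down_self by blast
  qed
qed

end

section \<open>Coordinates relative to a partition into two chains\<close>

locale two_chains = fin_poset +
  fixes C\<^sub>1 C\<^sub>2 :: "'a set"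
  assumes partition: "two_chain_partition A r C\<^sub>1 C\<^sub>2"
begin

lemma chains: "C\<^sub>1 \<in> Chains r" "C\<^sub>2 \<in> Chains r" "C\<^sub>1 \<union> C\<^sub>2 = A" "C\<^sub>1 \<inter> C\<^sub>2 = {}" "C\<^sub>1 \<subseteq> A" "C\<^sub>2 \<subseteq> A"
  using partition unfolding two_chain_partition_def by auto

lemma card_split:
  assumes "ideal I"
  shows "card I = card (I \<inter> C\<^sub>1) + card (I \<inter> C\<^sub>2)"
proof -
  have "I = (I \<inter> C\<^sub>1) \<union> (I \<inter> C\<^sub>2)" using chains(3) ideal_subset[OF assms] by blast
  then have "card I = card ((I \<inter> C\<^sub>1) \<union> (I \<inter> C\<^sub>2))" by simp
  also have "\<dots> = card (I \<inter> C\<^sub>1) + card (I \<inter> C\<^sub>2)"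
    using chains(4) ideal_finite[OF assms] by (intro card_Un_disjoint) auto
  finally show ?thesis .
qed

lemma ideal_subset_iff:
  assumes "ideal I" "ideal J"
  shows "I \<subseteq> J \<longleftrightarrow> card (I \<inter> C\<^sub>1) \<le> card (J \<inter> C\<^sub>1) \<and> card (I \<inter> C\<^sub>2) \<le> card (J \<inter> C\<^sub>2)"
proof
  assume "I \<subseteq> J"
  then show "card (I \<inter> C\<^sub>1) \<le> card (J \<inter> C\<^sub>1) \<and> card (I \<inter> C\<^sub>2) \<le> card (J \<inter> C\<^sub>2)"
    using ideal_finite[OF assms(2)] by (auto intro!: card_mono)
next
  assume "card (I \<inter> C\<^sub>1) \<le> card (J \<inter> C\<^sub>1) \<and> card (I \<inter> C\<^sub>2) \<le> card (J \<inter> C\<^sub>2)"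
  then have "I \<inter> C\<^sub>1 \<subseteq> J \<inter> C\<^sub>1" "I \<inter> C\<^sub>2 \<subseteq> J \<inter> C\<^sub>2"
    using chain_card_le[OF assms chains(1)] chain_card_le[OF assms chains(2)] by auto
  then show "I \<subseteq> J" using chains(3) ideal_subset[OF assms(1)] by blast
qed

lemma coord_inj: "inj_on (coord C\<^sub>1) (ideals t)"
proof (rule inj_onI)
  fix I J assume *: "I \<in> ideals t" "J \<in> ideals t" "coord C\<^sub>1 I = coord C\<^sub>1 J"
  then have IJ: "ideal I" "ideal J" "card I = card J" unfolding ideals_def by auto
  have "card (I \<inter> C\<^sub>1) = card (J \<inter> C\<^sub>1)" using *(3) unfolding coord_def by simp
  moreover from this have "card (I \<inter> C\<^sub>2) = card (J \<inter> C\<^sub>2)"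
    using card_split[OF IJ(1)] card_split[OF IJ(2)] IJ(3) by simp
  ultimately show "I = J"
    using ideal_subset_iff[OF IJ(1,2)] ideal_subset_iff[OF IJ(2,1)] by simp
qed

text \<open>Inclusion means that neither intersection with a chain shrinks; as the total grows by
  one, exactly one of them grows, by one. Hence saturated chains of ideals are lattice
  walks.\<close>

lemma ideal_cover_iff:
  assumes "I \<in> ideals t" "J \<in> ideals (Suc t)"
  shows "I \<subseteq> J \<longleftrightarrow> coord C\<^sub>1 I = coord C\<^sub>1 J \<or> coord C\<^sub>1 I = coord C\<^sub>1 J - 1"
proof -
  have IJ: "ideal I" "ideal J" "card I = t" "card J = Suc t" using assms unfolding ideals_def by auto
  show ?thesis
    unfolding ideal_subset_iff[OF IJ(1,2)] coord_def
    using card_split[OF IJ(1)] card_split[OF IJ(2)] IJ(3,4) by linarith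
qed

text \<open>An exchange: a minimal element of \<open>J - I\<close> replaces a maximal element of
  \<open>I - J\<close>. The intersections with the two chains are nested in opposite directions, so
  the former lies in \<open>C\<^sub>1\<close>, the latter in \<open>C\<^sub>2\<close>, and the
  coordinate rises by exactly one.\<close>

lemma coord_gap:
  assumes "I \<in> ideals t" "J \<in> ideals t" "coord C\<^sub>1 I < coord C\<^sub>1 J"
  shows "coord C\<^sub>1 I + 1 \<in> coords C\<^sub>1 t"
proof -
  have IJ: "ideal I" "ideal J" "card I = t" "card J = t" using assms unfolding ideals_def by auto
  have c1: "card (I \<inter> C\<^sub>1) < card (J \<inter> C\<^sub>1)" using assms(3) unfolding coord_def by simp
  then have c2: "card (J \<inter> C\<^sub>2) < card (I \<inter> C\<^sub>2)"
    using card_split[OF IJ(1)] card_split[OF IJ(2)] IJ(3,4) by simp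
  have s1: "I \<inter> C\<^sub>1 \<subseteq> J \<inter> C\<^sub>1" and s2: "J \<inter> C\<^sub>2 \<subseteq> I \<inter> C\<^sub>2"
    using chain_card_le[OF IJ(1,2) chains(1)] chain_card_le[OF IJ(2,1) chains(2)] c1 c2 by auto
  have fin: "finite (J - I)" "finite (I - J)" "J - I \<subseteq> A" "I - J \<subseteq> A"
    using ideal_finite[OF IJ(1)] ideal_finite[OF IJ(2)] ideal_subset[OF IJ(1)] ideal_subset[OF IJ(2)]
    by auto
  have "I \<inter> C\<^sub>1 \<noteq> J \<inter> C\<^sub>1" "J \<inter> C\<^sub>2 \<noteq> I \<inter> C\<^sub>2" using c1 c2 by auto
  then have "J - I \<noteq> {}" "I - J \<noteq> {}" using s1 s2 by blast+
  then obtain x y where x: "x \<in> J - I" "\<forall>z\<in>J - I. (z, x) \<in> r \<longrightarrow> z = x"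
    and y: "y \<in> I - J" "\<forall>z\<in>I - J. (y, z) \<in> r \<longrightarrow> z = y"
    using min_exists[OF fin(1) _ fin(3)] max_exists[OF fin(2) _ fin(4)] by blast
  have xC: "x \<in> C\<^sub>1" "x \<notin> C\<^sub>2" using x s2 chains(3,4) fin(3) by blast+
  have yC: "y \<in> C\<^sub>2" "y \<notin> C\<^sub>1" using y s1 chains(3,4) fin(4) by blast+
  have yx: "(y, x) \<notin> r" using idealD[OF IJ(2)] x y by blast
  let ?M = "insert x I - {y}"
  have iM: "ideal ?M"
    unfolding ideal_def
  proof (intro conjI allI impI)
    show "?M \<subseteq> A" using ideal_subset[OF IJ(1)] fin(3) x by blast
    fix z w assume zw: "(z, w) \<in> r" "w \<in> ?M"
    have "z \<noteq> y"
    proof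
      assume "z = y"
      then have "w \<noteq> x" "w \<in> I" "w \<noteq> y" using zw yx by auto
      moreover have "w \<notin> J" using idealD[OF IJ(2) zw(1)] \<open>z = y\<close> y by blast
      ultimately show False using y zw(1) \<open>z = y\<close> by blast
    qed
    moreover have "z \<in> insert x I"
    proof (cases "w = x")
      case True
      then have "z \<in> J" using idealD[OF IJ(2)] zw(1) x by blast
      then show ?thesis using x zw(1) True by blast
    next
      case False
      then show ?thesis using idealD[OF IJ(1) zw(1)] zw(2) by blast
    qed
    ultimately show "z \<in> ?M" by blast
  qed
  have "card ?M = t" using x y IJ(3) ideal_finite[OF IJ(1)] by (simp add: card.insert_remove)
  then have "?M \<in> ideals t" using iM unfolding ideals_def by blast
  moreover have "?M \<inter> C\<^sub>1 = insert x (I \<inter> C\<^sub>1)" using xC yC by blast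
  then have "coord C\<^sub>1 ?M = coord C\<^sub>1 I + 1" unfolding coord_def using x ideal_finite[OF IJ(1)] by simp
  ultimately show ?thesis unfolding coords_def by force
qed

lemma finite_coords: "finite (coords C\<^sub>1 t)"
  unfolding coords_def using finite_ideals by blast

lemma coords_nonempty:
  assumes "t \<le> card A"
  shows "coords C\<^sub>1 t \<noteq> {}"
  using ideal_between[OF ideal_empty ideal_ground, of t] assms unfolding coords_def by auto

lemma coords_interval:
  assumes "t \<le> card A"
  shows "coords C\<^sub>1 t = {Min (coords C\<^sub>1 t)..Max (coords C\<^sub>1 t)}"
proof
  show "coords C\<^sub>1 t \<subseteq> {Min (coords C\<^sub>1 t)..Max (coords C\<^sub>1 t)}" using finite_coords by auto
  let ?l = "Min (coords C\<^sub>1 t)" and ?u = "Max (coords C\<^sub>1 t)"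
  have "?l + int d \<in> coords C\<^sub>1 t" if "?l + int d \<le> ?u" for d
    using that
  proof (induction d)
    case 0
    then show ?case using Min_in[OF finite_coords coords_nonempty[OF assms]] by simp
  next
    case (Suc d)
    then obtain I where I: "I \<in> ideals t" "coord C\<^sub>1 I = ?l + int d" unfolding coords_def by force
    obtain J where J: "J \<in> ideals t" "coord C\<^sub>1 J = ?u"
      using Max_in[OF finite_coords coords_nonempty[OF assms]] unfolding coords_def by force
    show ?case using coord_gap[OF I(1) J(1)] I(2) J(2) Suc.prems by (simp add: algebra_simps)
  qed
  note up = this
  show "{?l..?u} \<subseteq> coords C\<^sub>1 t"
  proof
    fix a assume "a \<in> {?l..?u}"
    then show "a \<in> coords C\<^sub>1 t" using up[of "nat (a - ?l)"] by simp
  qed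
qed

lemma coords_down:
  assumes "a \<in> coords C\<^sub>1 (Suc t)"
  shows "a \<in> coords C\<^sub>1 t \<or> a - 1 \<in> coords C\<^sub>1 t"
proof -
  obtain J where J: "J \<in> ideals (Suc t)" "a = coord C\<^sub>1 J" using assms unfolding coords_def by blast
  then obtain I where I: "I \<in> ideals t" "I \<subseteq> J"
    using ideal_between[OF ideal_empty, of J t] unfolding ideals_def by auto
  then have "coord C\<^sub>1 I = a \<or> coord C\<^sub>1 I = a - 1" using ideal_cover_iff[OF I(1) J(1)] J(2) by simp
  moreover have "coord C\<^sub>1 I \<in> coords C\<^sub>1 t" using I(1) unfolding coords_def by (rule imageI)
  ultimately show ?thesis by auto
qed

lemma coords_up:
  assumes "a \<in> coords C\<^sub>1 t" "t < card A"
  shows "a \<in> coords C\<^sub>1 (Suc t) \<or> a + 1 \<in> coords C\<^sub>1 (Suc t)"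
proof -
  obtain I where I: "I \<in> ideals t" "a = coord C\<^sub>1 I" using assms unfolding coords_def by blast
  then have "ideal I" "card I \<le> Suc t" unfolding ideals_def by auto
  then obtain J where J: "J \<in> ideals (Suc t)" "I \<subseteq> J"
    using ideal_between[OF _ ideal_ground ideal_subset, of I "Suc t"] assms(2) by auto
  then have "coord C\<^sub>1 J = a \<or> coord C\<^sub>1 J = a + 1" using ideal_cover_iff[OF I(1) J(1)] I(2) by auto
  moreover have "coord C\<^sub>1 J \<in> coords C\<^sub>1 (Suc t)" using J(1) unfolding coords_def by (rule imageI)
  ultimately show ?thesis by auto
qed

text \<open>Adding or removing one element changes the coordinate by 0 or 1. Applied to the extreme
  ideals of neighbouring ranks, this bounds the move of each endpoint from both sides.\<close>

lemma region_coords: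
  "region (card A) (coords C\<^sub>1) (\<lambda>t. Min (coords C\<^sub>1 t)) (\<lambda>t. Max (coords C\<^sub>1 t))"
proof -
  let ?l = "\<lambda>t. Min (coords C\<^sub>1 t)" and ?u = "\<lambda>t. Max (coords C\<^sub>1 t)"
  have 0: "coords C\<^sub>1 0 = {0}" unfolding coords_def coord_def by (simp add: ideals_zero)
  have le: "?l t \<le> ?u t" if "t \<le> card A" for t
    using finite_coords coords_nonempty[OF that] by simp
  have steps: "?l (Suc t) - ?l t \<in> {0, 1} \<and> ?u (Suc t) - ?u t \<in> {0, 1}" if t: "t < card A" for t
  proof -
    have int: "a \<in> coords C\<^sub>1 t \<longleftrightarrow> ?l t \<le> a \<and> a \<le> ?u t"
      "a \<in> coords C\<^sub>1 (Suc t) \<longleftrightarrow> ?l (Suc t) \<le> a \<and> a \<le> ?u (Suc t)" for a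
      using coords_interval[of t] coords_interval[of "Suc t"] t by auto
    have "?l t \<le> ?u t" "?l (Suc t) \<le> ?u (Suc t)" using le t by auto
    then show ?thesis
      using coords_down[of "?l (Suc t)" t] coords_down[of "?u (Suc t)" t]
        coords_up[of "?l t" t] coords_up[of "?u t" t] t unfolding int by auto
  qed
  show ?thesis
    unfolding region_def using 0 le coords_interval steps by simp
qed

lemma path_count_walk:
  "I \<in> ideals (i + s) \<Longrightarrow> int (path_count i s I) = walk (coords C\<^sub>1) i s (coord C\<^sub>1 I)"
proof (induction s arbitrary: I)
  case 0
  then show ?case by (simp add: path_count_0 coords_def)
next
  case (Suc s)
  let ?a = "coord C\<^sub>1 I" and ?w = "walk (coords C\<^sub>1) i s"
  let ?S = "{J. J \<in> ideals (i + s) \<and> J \<subseteq> I}"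
  have I: "I \<in> ideals (Suc (i + s))" using Suc.prems by simp
  have "int (path_count i (Suc s) I) = (\<Sum>J\<in>?S. int (path_count i s J))"
    unfolding path_count_Suc by simp
  also have "\<dots> = (\<Sum>J\<in>?S. ?w (coord C\<^sub>1 J))"
    using Suc.IH by (intro sum.cong) auto
  also have "\<dots> = (\<Sum>a\<in>coord C\<^sub>1 ` ?S. ?w a)"
    using inj_on_subset[OF coord_inj, of ?S "i + s"] by (subst sum.reindex) auto
  also have "coord C\<^sub>1 ` ?S = {?a, ?a - 1} \<inter> coords C\<^sub>1 (i + s)"
    unfolding coords_def using ideal_cover_iff[OF _ I] by auto
  also have "(\<Sum>a\<in>{?a, ?a - 1} \<inter> coords C\<^sub>1 (i + s). ?w a) = (\<Sum>a\<in>{?a, ?a - 1}. ?w a)"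
    using walk_outside[of _ "coords C\<^sub>1" i s] by (intro sum.mono_neutral_left) auto
  also have "\<dots> = walk (coords C\<^sub>1) i (Suc s) ?a"
    using Suc.prems by (simp add: walk.simps(2) coords_def)
  finally show ?case .
qed

lemma path_total_walk:
  "int (path_total i s) = (\<Sum>a\<in>coords C\<^sub>1 (i + s). walk (coords C\<^sub>1) i s a)"
  unfolding path_total_eq coords_def sum.reindex[OF coord_inj]
  by (simp add: path_count_walk[unfolded coords_def])

text \<open>At a rank with only one ideal the two chains may be exchanged above it, which reflects the
  coordinates of all higher ideals.\<close>

lemma swap_above:
  assumes "coords C\<^sub>1 k = {b}"
  shows "\<exists>D\<^sub>1 D\<^sub>2. two_chains A r D\<^sub>1 D\<^sub>2 \<and> (\<forall>t\<le>k. coords D\<^sub>1 t = coords C\<^sub>1 t) \<and>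
    (\<forall>t\<ge>k. coords D\<^sub>1 t = (\<lambda>a. (2 * b + int t - int k) - a) ` coords C\<^sub>1 t)"
proof -
  obtain I where I: "ideals k = {I}"
  proof -
    have "card (ideals k) = 1" using card_image[OF coord_inj, of k] assms unfolding coords_def by simp
    then show ?thesis using card_1_singletonE that by blast
  qed
  have iI: "ideal I" "card I = k" using I unfolding ideals_def by auto
  have b: "int (card (I \<inter> C\<^sub>1)) = b" using assms I unfolding coords_def coord_def by simp
  have below: "(x, y) \<in> r" if "x \<in> I" "y \<in> A" "y \<notin> I" for x y
    using ideals_sandwich[OF I that] .
  define D\<^sub>1 where "D\<^sub>1 = (C\<^sub>1 \<inter> I) \<union> (C\<^sub>2 - I)"
  define D\<^sub>2 where "D\<^sub>2 = (C\<^sub>2 \<inter> I) \<union> (C\<^sub>1 - I)"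
  have "D\<^sub>1 \<in> Chains r" "D\<^sub>2 \<in> Chains r"
    unfolding D\<^sub>1_def D\<^sub>2_def
    by (rule chain_append; use chains below in \<open>auto intro: chain_subset\<close>)+
  then have "two_chain_partition A r D\<^sub>1 D\<^sub>2"
    unfolding two_chain_partition_def using chains(3,4) unfolding D\<^sub>1_def D\<^sub>2_def by blast
  then have "two_chains A r D\<^sub>1 D\<^sub>2"
    by (intro two_chains.intro two_chains_axioms.intro fin_poset_axioms)
  moreover have "coords D\<^sub>1 t = coords C\<^sub>1 t" if t: "t \<le> k" for t
  proof -
    have "coord D\<^sub>1 J = coord C\<^sub>1 J" if J: "J \<in> ideals t" for J
    proof -
      have J': "ideal J" "card J = t" using J unfolding ideals_def by auto
      \<comment> \<open>An ideal reaching outside \<open>I\<close> contains all of \<open>I\<close>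
        and so has more than \<open>k\<close> elements.\<close>
      have "J \<subseteq> I"
      proof (rule ccontr)
        assume "\<not> J \<subseteq> I"
        then obtain y where y: "y \<in> J" "y \<notin> I" by blast
        then have "I \<subseteq> J" using below idealD[OF J'(1)] ideal_subset[OF J'(1)] by blast
        then have "I \<subset> J" using y by blast
        then have "card I < card J" using ideal_finite[OF J'(1)] by (intro psubset_card_mono)
        then show False using t J' iI by simp
      qed
      then have "J \<inter> D\<^sub>1 = J \<inter> C\<^sub>1" unfolding D\<^sub>1_def using chains(4) by blast
      then show ?thesis unfolding coord_def by simp
    qed
    then show ?thesis unfolding coords_def by (rule image_cong[OF refl])
  qed
  moreover have "coords D\<^sub>1 t = (\<lambda>a. (2 * b + int t - int k) - a) ` coords C\<^sub>1 t" if t: "t \<ge> k" for t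
  proof -
    have "coord D\<^sub>1 J = (2 * b + int t - int k) - coord C\<^sub>1 J" if J: "J \<in> ideals t" for J
    proof -
      have J': "ideal J" "card J = t" using J unfolding ideals_def by auto
      have fin: "finite I" "finite J" using ideal_finite J' iI by auto
      have IJ: "I \<subseteq> J"
      proof (rule ccontr)
        assume "\<not> I \<subseteq> J"
        then obtain x where x: "x \<in> I" "x \<notin> J" by blast
        then have "J \<subseteq> I" using below[OF x(1)] idealD[OF J'(1)] ideal_subset[OF J'(1)] by blast
        then have "J \<subset> I" using x by blast
        then have "card J < card I" using fin by (intro psubset_card_mono)
        then show False using t J' iI by simp
      qed
      \<comment> \<open>The new coordinate is that of \<open>I\<close> plus what \<open>J\<close>
        gains on \<open>C\<^sub>2\<close> above \<open>I\<close>. For old coordinate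
        \<open>a\<close> the gain is \<open>(t - a) - (k - b)\<close>, which gives the reflection
        formula.\<close>
      have "J \<inter> D\<^sub>1 = (I \<inter> C\<^sub>1) \<union> (J \<inter> C\<^sub>2 - I \<inter> C\<^sub>2)" unfolding D\<^sub>1_def using IJ by blast
      then have "card (J \<inter> D\<^sub>1) = card ((I \<inter> C\<^sub>1) \<union> (J \<inter> C\<^sub>2 - I \<inter> C\<^sub>2))" by simp
      also have "\<dots> = card (I \<inter> C\<^sub>1) + card (J \<inter> C\<^sub>2 - I \<inter> C\<^sub>2)"
        using fin chains(4) by (intro card_Un_disjoint) auto
      also have "int \<dots> = b + (int (card (J \<inter> C\<^sub>2)) - int (card (I \<inter> C\<^sub>2)))"
      proof -
        have "I \<inter> C\<^sub>2 \<subseteq> J \<inter> C\<^sub>2" using IJ by blast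
        then have "card (J \<inter> C\<^sub>2 - I \<inter> C\<^sub>2) = card (J \<inter> C\<^sub>2) - card (I \<inter> C\<^sub>2)"
          "card (I \<inter> C\<^sub>2) \<le> card (J \<inter> C\<^sub>2)"
          using fin by (auto intro: card_Diff_subset card_mono)
        then show ?thesis using b by simp
      qed
      finally show ?thesis
        using card_split[OF iI(1)] card_split[OF J'(1)] iI(2) J'(2) b unfolding coord_def by linarith
    qed
    then show ?thesis unfolding coords_def image_image by (rule image_cong[OF refl])
  qed
  ultimately show ?thesis by blast
qed

text \<open>An element is below \<open>y\<close> iff it lies in every ideal containing
  \<open>y\<close>, and membership in an ideal compares a position with the size of an intersection.
  The order is thereby expressed through numbers alone.\<close>

lemma rel_iff_pos:
  assumes "C \<in> {C\<^sub>1, C\<^sub>2}" "D \<in> {C\<^sub>1, C\<^sub>2}" "x \<in> C" "y \<in> D"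
  shows "(x, y) \<in> r \<longleftrightarrow> (\<forall>I. ideal I \<longrightarrow> pos D y \<le> card (I \<inter> D) \<longrightarrow> pos C x \<le> card (I \<inter> C))"
proof -
  have CD: "C \<in> Chains r" "C \<subseteq> A" "D \<in> Chains r" "D \<subseteq> A" using assms(1,2) chains by auto
  have "(x, y) \<in> r \<longleftrightarrow> (\<forall>I. ideal I \<longrightarrow> y \<in> I \<longrightarrow> x \<in> I)"
  proof
    assume "\<forall>I. ideal I \<longrightarrow> y \<in> I \<longrightarrow> x \<in> I"
    then have "x \<in> down y" using ideal_down down_self CD(4) assms(4) by blast
    then show "(x, y) \<in> r" unfolding down_def by blast
  qed (use idealD in blast)
  then show ?thesis
    using mem_ideal_iff_pos[OF CD(1,2) assms(3)] mem_ideal_iff_pos[OF CD(3,4) assms(4)] by simp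
qed

lemma coords_top: "coords C\<^sub>1 (card A) = {int (card C\<^sub>1)}"
  unfolding coords_def coord_def ideals_top using chains(5) by (simp add: Int_absorb1)

end

section \<open>Recovering the poset\<close>

lemma path_total_eq_if_K_eq:
  assumes "fin_poset A r" "fin_poset B s" "K A r = K B s" "i + d \<le> card A"
  shows "fin_poset.path_total A r i d = fin_poset.path_total B s i d"
proof -
  interpret P: fin_poset A r by fact
  interpret Q: fin_poset B s by fact
  show ?thesis
    unfolding P.path_total_def Q.path_total_def
    by (rule chain_count_eq_if_K_eq[OF assms(1-3)])
      (use assms(4) in \<open>auto simp: rank_seq_def split: nat.split\<close>)
qed

text \<open>The criterion \<open>maxs_le_two_iff\<close> is an equation between chain counts that
  \<open>K\<close> determines; for \<open>k + 2 > card A\<close> there are no ideals to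
  check.\<close>

lemma width_le_two_if_K_eq:
  assumes "fin_poset A r" "fin_poset B s" "K A r = K B s" "poset_width A r \<le> 2"
  shows "poset_width B s \<le> 2"
proof -
  interpret P: fin_poset A r by fact
  interpret Q: fin_poset B s by fact
  note cards = card_eq_if_K_eq[OF assms(1-3)]
  have "\<forall>J\<in>Q.ideals (k + 2). card (Q.maxs J) \<le> 2" for k
  proof (cases "k + 2 \<le> card A")
    case True
    have "P.chain_count 3 (skip_seq k) A = Q.chain_count 3 (skip_seq k) B"
      by (rule chain_count_eq_if_K_eq[OF assms(1-3)])
        (use True in \<open>auto simp: skip_seq_def split: nat.split\<close>)
    moreover have "P.path_total k 2 = Q.path_total k 2" "P.path_total (k + 2) 0 = Q.path_total (k + 2) 0"
      "P.path_total (k + 1) 1 = Q.path_total (k + 1) 1"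
      using True by (auto intro!: path_total_eq_if_K_eq[OF assms(1-3)])
    ultimately show ?thesis
      using assms(4) P.maxs_le_two_iff[of k] Q.maxs_le_two_iff[of k]
      unfolding P.poset_width_le_iff P.antichain_le_two_iff by simp
  next
    case False
    then show ?thesis using Q.ideals_card_le cards by fastforce
  qed
  then show ?thesis unfolding Q.poset_width_le_iff Q.antichain_le_two_iff by blast
qed

lemma two_chains_if_width_le_two:
  assumes "fin_poset A r" "poset_width A r \<le> 2"
  shows "\<exists>C\<^sub>1 C\<^sub>2. two_chains A r C\<^sub>1 C\<^sub>2"
proof -
  interpret fin_poset A r by fact
  show ?thesis
    using dilworth_width_two[OF _ ideal_ground] assms
    unfolding poset_width_le_iff two_chains_def two_chains_axioms_def two_chain_partition_def by blast
qed

text \<open>The chains of \<open>A\<close> are kept and those of \<open>B\<close> adapted rank by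
  rank: a disagreement at the next rank is a reflection above a one-point rank and is undone by
  exchanging the chains of \<open>B\<close> there. The ranks matched before stay matched, since the
  region is symmetric in between.\<close>

lemma coords_match_if_K_eq:
  assumes "two_chains A r C\<^sub>1 C\<^sub>2" "two_chains B s E\<^sub>1 E\<^sub>2" "K A r = K B s" "j \<le> card A"
  shows "\<exists>D\<^sub>1 D\<^sub>2. two_chains B s D\<^sub>1 D\<^sub>2 \<and>
    (\<forall>t\<le>j. fin_poset.coords A r C\<^sub>1 t = fin_poset.coords B s D\<^sub>1 t)"
  using assms(4)
proof (induction j)
  case 0
  interpret P: two_chains A r C\<^sub>1 C\<^sub>2 by fact
  interpret Q: two_chains B s E\<^sub>1 E\<^sub>2 by fact
  have "P.coords C\<^sub>1 0 = Q.coords E\<^sub>1 0"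
    unfolding P.coords_def Q.coords_def P.coord_def Q.coord_def P.ideals_zero Q.ideals_zero by simp
  then show ?case using assms(2) by auto
next
  case (Suc j)
  then obtain D\<^sub>1 D\<^sub>2 where D: "two_chains B s D\<^sub>1 D\<^sub>2"
    and agree: "\<And>t. t \<le> j \<Longrightarrow> fin_poset.coords A r C\<^sub>1 t = fin_poset.coords B s D\<^sub>1 t" by auto
  interpret P: two_chains A r C\<^sub>1 C\<^sub>2 by fact
  interpret Q: two_chains B s D\<^sub>1 D\<^sub>2 by fact
  note fp = P.fin_poset_axioms Q.fin_poset_axioms
  have cards: "card A = card B" using card_eq_if_K_eq[OF fp assms(3)] .
  have RQ: "region (card A) (Q.coords D\<^sub>1) (\<lambda>t. Min (Q.coords D\<^sub>1 t)) (\<lambda>t. Max (Q.coords D\<^sub>1 t))"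
    using Q.region_coords unfolding cards .
  have total: "(\<Sum>a\<in>P.coords C\<^sub>1 (Suc j). walk (P.coords C\<^sub>1) i (Suc j - i) a) =
      (\<Sum>a\<in>Q.coords D\<^sub>1 (Suc j). walk (Q.coords D\<^sub>1) i (Suc j - i) a)" if "i \<le> Suc j" for i
  proof -
    have "i + (Suc j - i) = Suc j" using that by simp
    then show ?thesis
      using path_total_eq_if_K_eq[OF fp assms(3), of i "Suc j - i"] Suc.prems
        P.path_total_walk[of i "Suc j - i"] Q.path_total_walk[of i "Suc j - i"] by simp
  qed
  from regions_agree_step[OF P.region_coords RQ _ agree total] Suc.prems
  consider "P.coords C\<^sub>1 (Suc j) = Q.coords D\<^sub>1 (Suc j)"
    | k b where "k \<le> j" "Q.coords D\<^sub>1 k = {b}" "\<And>t. k \<le> t \<Longrightarrow> t \<le> Suc j \<Longrightarrow>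
        P.coords C\<^sub>1 t = (\<lambda>a. (2 * b + int t - int k) - a) ` Q.coords D\<^sub>1 t"
    by auto
  then show ?case
  proof cases
    case 1
    then have "P.coords C\<^sub>1 t = Q.coords D\<^sub>1 t" if "t \<le> Suc j" for t
      using agree that by (cases "t = Suc j") auto
    then show ?thesis using D by blast
  next
    case 2
    from Q.swap_above[OF 2(2)] obtain F\<^sub>1 F\<^sub>2 where F: "two_chains B s F\<^sub>1 F\<^sub>2"
      "\<And>t. t \<le> k \<Longrightarrow> Q.coords F\<^sub>1 t = Q.coords D\<^sub>1 t"
      "\<And>t. t \<ge> k \<Longrightarrow> Q.coords F\<^sub>1 t = (\<lambda>a. (2 * b + int t - int k) - a) ` Q.coords D\<^sub>1 t" by blast
    have "P.coords C\<^sub>1 t = Q.coords F\<^sub>1 t" if "t \<le> Suc j" for t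
    proof (cases "t \<le> k")
      case True
      then show ?thesis using F(2) agree 2(1) by simp
    next
      case False
      then show ?thesis using F(3)[of t] 2(3)[of t] that by simp
    qed
    then show ?thesis using F(1) by blast
  qed
qed

text \<open>Equal coordinates provide, for each ideal on one side, one on the other with the same
  intersection sizes, and these sizes determine the order by \<open>rel_iff_pos\<close>. The
  isomorphism preserves the position in the respective chain.\<close>

lemma poset_iso_if_coords_eq:
  assumes "two_chains A r C\<^sub>1 C\<^sub>2" "two_chains B s D\<^sub>1 D\<^sub>2" "card A = card B"
    and coords: "\<And>t. t \<le> card A \<Longrightarrow> fin_poset.coords A r C\<^sub>1 t = fin_poset.coords B s D\<^sub>1 t"
  shows "poset_iso A r B s"
proof -
  interpret P: two_chains A r C\<^sub>1 C\<^sub>2 by fact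
  interpret Q: two_chains B s D\<^sub>1 D\<^sub>2 by fact
  have fin: "finite C\<^sub>1" "finite C\<^sub>2" "finite D\<^sub>1" "finite D\<^sub>2"
    using P.chains Q.chains P.finite_ground Q.finite_ground finite_subset by blast+
  have cards1: "card C\<^sub>1 = card D\<^sub>1"
    using coords[of "card A"] P.coords_top Q.coords_top assms(3) by simp
  have cards2: "card C\<^sub>2 = card D\<^sub>2"
    using P.card_split[OF P.ideal_ground] Q.card_split[OF Q.ideal_ground] cards1 assms(3)
      P.chains Q.chains by (simp add: Int_absorb1)
  have match: "\<exists>J. Q.ideal J \<and> card (J \<inter> D\<^sub>1) = card (I \<inter> C\<^sub>1) \<and> card (J \<inter> D\<^sub>2) = card (I \<inter> C\<^sub>2)"
    if I: "P.ideal I" for I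
  proof -
    have k: "I \<in> P.ideals (card I)" using I unfolding P.ideals_def by simp
    then have "int (card (I \<inter> C\<^sub>1)) \<in> Q.coords D\<^sub>1 (card I)"
      using coords[OF P.ideals_card_le[OF k]] unfolding P.coords_def P.coord_def by blast
    then obtain J where "Q.ideal J" "card J = card I" "card (J \<inter> D\<^sub>1) = card (I \<inter> C\<^sub>1)"
      unfolding Q.coords_def Q.coord_def Q.ideals_def by auto
    then show ?thesis using P.card_split[OF I] Q.card_split by fastforce
  qed
  have match': "\<exists>I. P.ideal I \<and> card (I \<inter> C\<^sub>1) = card (J \<inter> D\<^sub>1) \<and> card (I \<inter> C\<^sub>2) = card (J \<inter> D\<^sub>2)"
    if J: "Q.ideal J" for J
  proof -
    have k: "J \<in> Q.ideals (card J)" using J unfolding Q.ideals_def by simp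
    then have "int (card (J \<inter> D\<^sub>1)) \<in> P.coords C\<^sub>1 (card J)"
      using coords[of "card J"] Q.ideals_card_le[OF k] assms(3) unfolding Q.coords_def Q.coord_def by auto
    then obtain I where "P.ideal I" "card I = card J" "card (I \<inter> C\<^sub>1) = card (J \<inter> D\<^sub>1)"
      unfolding P.coords_def P.coord_def P.ideals_def by auto
    then show ?thesis using Q.card_split[OF J] P.card_split by fastforce
  qed
  \<comment> \<open>Indexing by a truth value covers comparisons within a chain and across the
    chains in one statement.\<close>
  define C D where "C b = (if b then C\<^sub>1 else C\<^sub>2)" and "D b = (if b then D\<^sub>1 else D\<^sub>2)" for b
  have CD: "C b \<in> {C\<^sub>1, C\<^sub>2}" "D b \<in> {D\<^sub>1, D\<^sub>2}" "C b \<in> Chains r" "D b \<in> Chains s" "C b \<subseteq> A" "D b \<subseteq> B"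
    "card (C b) = card (D b)" for b
    unfolding C_def D_def using P.chains Q.chains cards1 cards2 by auto
  define g where "g b = inv_into (D b) (Q.pos (D b)) \<circ> P.pos (C b)" for b
  have g: "bij_betw (g b) (C b) (D b)" for b
    unfolding g_def using P.bij_pos[OF CD(3,5), of b] bij_betw_inv_into[OF Q.bij_pos[OF CD(4,6), of b]] CD(7)
    by (intro bij_betw_trans) auto
  have gpos: "Q.pos (D b) (g b x) = P.pos (C b) x" if "x \<in> C b" for b x
  proof -
    have "P.pos (C b) x \<in> {1..card (C b)}" using bij_betwE[OF P.bij_pos[OF CD(3,5)]] that by blast
    then have "P.pos (C b) x \<in> Q.pos (D b) ` D b"
      using Q.bij_pos[OF CD(4,6), of b] CD(7) unfolding bij_betw_def by simp
    then show ?thesis unfolding g_def by (simp add: f_inv_into_f)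
  qed
  have grel: "(x, y) \<in> r \<longleftrightarrow> (g b x, g c y) \<in> s" if xy: "x \<in> C b" "y \<in> C c" for b c x y
  proof -
    have gD: "g b x \<in> D b" "g c y \<in> D c" using bij_betwE[OF g] xy by blast+
    have m: "\<exists>J. Q.ideal J \<and> (\<forall>b. card (J \<inter> D b) = card (I \<inter> C b))" if "P.ideal I" for I
      using match[OF that] unfolding C_def D_def by auto
    have m': "\<exists>I. P.ideal I \<and> (\<forall>b. card (I \<inter> C b) = card (J \<inter> D b))" if "Q.ideal J" for J
      using match'[OF that] unfolding C_def D_def by auto
    show ?thesis
      unfolding P.rel_iff_pos[OF CD(1,1) xy] Q.rel_iff_pos[OF CD(2,2) gD] gpos[OF xy(1)] gpos[OF xy(2)]
      using m m' by metis
  qed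
  define f where "f x = (if x \<in> C\<^sub>1 then g True x else g False x)" for x
  have f: "f x = g b x" if "x \<in> C b" for b x
    using that P.chains(4) unfolding f_def C_def by (auto split: if_splits)
  have "bij_betw f (C True \<union> C False) (D True \<union> D False)"
  proof (rule bij_betw_combine)
    show "bij_betw f (C True) (D True)" using g[of True] f by (simp cong: bij_betw_cong)
    show "bij_betw f (C False) (D False)" using g[of False] f by (simp cong: bij_betw_cong)
    show "D True \<inter> D False = {}" unfolding D_def using Q.chains(4) by simp
  qed
  then have "bij_betw f A B" unfolding C_def D_def using P.chains(3) Q.chains(3) by simp
  moreover have "(x, y) \<in> r \<longleftrightarrow> (f x, f y) \<in> s" if xy: "x \<in> A" "y \<in> A" for x y
  proof -
    obtain b c where bc: "x \<in> C b" "y \<in> C c" using xy P.chains(3) unfolding C_def by (metis UnE)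
    show ?thesis unfolding f[OF bc(1)] f[OF bc(2)] by (rule grel[OF bc])
  qed
  ultimately show ?thesis unfolding poset_iso_def by blast
qed

lemma poset_iso_sym:
  assumes "poset_iso A r B s"
  shows "poset_iso B s A r"
proof -
  obtain f where f: "bij_betw f A B" "\<And>x y. x \<in> A \<Longrightarrow> y \<in> A \<Longrightarrow> (x, y) \<in> r \<longleftrightarrow> (f x, f y) \<in> s"
    using assms unfolding poset_iso_def by blast
  let ?g = "inv_into A f"
  have "bij_betw ?g B A" using bij_betw_inv_into[OF f(1)] .
  moreover have "(x, y) \<in> s \<longleftrightarrow> (?g x, ?g y) \<in> r" if "x \<in> B" "y \<in> B" for x y
    using f(2)[of "?g x" "?g y"] that bij_betwE[OF \<open>bij_betw ?g B A\<close>] bij_betw_inv_into_right[OF f(1)]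
    by simp
  ultimately show ?thesis unfolding poset_iso_def by blast
qed

lemma poset_iso_if_K_eq:
  assumes "fin_poset A r" "fin_poset B s" "K A r = K B s" "poset_width A r \<le> 2"
  shows "poset_iso A r B s"
proof -
  obtain C\<^sub>1 C\<^sub>2 where C: "two_chains A r C\<^sub>1 C\<^sub>2"
    using two_chains_if_width_le_two assms(1,4) by blast
  obtain E\<^sub>1 E\<^sub>2 where E: "two_chains B s E\<^sub>1 E\<^sub>2"
    using two_chains_if_width_le_two[OF assms(2)] width_le_two_if_K_eq[OF assms] by blast
  obtain D\<^sub>1 D\<^sub>2 where "two_chains B s D\<^sub>1 D\<^sub>2"
    "\<And>t. t \<le> card A \<Longrightarrow> fin_poset.coords A r C\<^sub>1 t = fin_poset.coords B s D\<^sub>1 t"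
    using coords_match_if_K_eq[OF C E assms(3) order_refl] by blast
  then show ?thesis
    using poset_iso_if_coords_eq[OF C] card_eq_if_K_eq[OF assms(1-3)] by blast
qed

section \<open>Uniqueness of the chain partition of an irreducible poset\<close>

context fin_poset
begin

lemma not_irreducible:
  assumes "I \<noteq> {}" "I \<subset> A" "\<And>x y. x \<in> I \<Longrightarrow> y \<in> A - I \<Longrightarrow> (x, y) \<in> r"
  shows "\<not> irreducible_poset A r"
proof -
  let ?R = "\<lambda>S. {(x, y) \<in> r. x \<in> S \<and> y \<in> S}"
  have po: "partial_order_on S (?R S)" if "S \<subseteq> A" for S
    unfolding partial_order_on_def preorder_on_def refl_on_def antisym_def trans_def
    using that refl_rel antisym_rel trans_rel by blast
  have above: "(y, x) \<notin> r" if "x \<in> I" "y \<in> A - I" for x y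
    using assms(3)[OF that] antisym_rel that by blast
  let ?f = "\<lambda>x. if x \<in> I then Inl x else Inr x"
  have "bij_betw ?f A (I <+> (A - I))"
    unfolding bij_betw_def inj_on_def using assms(2) by (auto split: if_splits)
  moreover have "(x, y) \<in> r \<longleftrightarrow> (?f x, ?f y) \<in> ordinal_sum I (?R I) (A - I) (?R (A - I))"
    if "x \<in> A" "y \<in> A" for x y
    unfolding ordinal_sum_def using that assms(3) above by auto
  ultimately have "poset_iso A r (I <+> (A - I)) (ordinal_sum I (?R I) (A - I) (?R (A - I)))"
    unfolding poset_iso_def by blast
  then show ?thesis
    unfolding irreducible_poset_def using po[of I] po[of "A - I"] assms(1,2) by blast
qed

text \<open>A minimal element of the poset, say in \<open>S\<close>, is below all of
  \<open>T\<close>. The elements of \<open>S\<close> below all of \<open>T\<close> are then a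
  nonempty lower summand: any other element of \<open>S\<close> is above some element of
  \<open>T\<close>, hence above all of them.\<close>

lemma irreducible_if_cross_comparable:
  assumes "irreducible_poset A r" "S \<union> T = A" "S \<inter> T = {}"
    and cross: "\<And>x y. x \<in> S \<Longrightarrow> y \<in> T \<Longrightarrow> (x, y) \<in> r \<or> (y, x) \<in> r"
  shows "S = {} \<or> T = {}"
proof (rule ccontr)
  assume ne: "\<not> (S = {} \<or> T = {})"
  then have "A \<noteq> {}" using assms(2) by blast
  then obtain m where m: "m \<in> A" "\<forall>y\<in>A. (y, m) \<in> r \<longrightarrow> y = m"
    using min_exists[of A] finite_ground by blast
  have False if ST: "S \<union> T = A" "S \<inter> T = {}" "T \<noteq> {}" "m \<in> S"
    and cr: "\<And>x y. x \<in> S \<Longrightarrow> y \<in> T \<Longrightarrow> (x, y) \<in> r \<or> (y, x) \<in> r" for S T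
  proof -
    let ?I = "{x \<in> S. \<forall>y\<in>T. (x, y) \<in> r}"
    have "(m, y) \<in> r" if "y \<in> T" for y
    proof -
      have "y \<in> A" "y \<noteq> m" using that ST by blast+
      then show ?thesis using cr[OF ST(4) that] m(2) by blast
    qed
    then have "m \<in> ?I" using ST(4) by blast
    moreover have "?I \<subset> A" using ST by blast
    moreover have "(x, y) \<in> r" if x: "x \<in> ?I" and y: "y \<in> A - ?I" for x y
    proof (cases "y \<in> T")
      case False
      then have "y \<in> S" using y ST(1) by blast
      then obtain z where z: "z \<in> T" "(y, z) \<notin> r" using y by blast
      then have "(z, y) \<in> r" using cr[OF \<open>y \<in> S\<close>] by blast
      moreover have "(x, z) \<in> r" using x z(1) by blast
      ultimately show ?thesis using trans_rel by blast
    qed (use x in blast)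
    ultimately show False using not_irreducible[of ?I] assms(1) by blast
  qed
  note key = this
  have "m \<in> S \<or> m \<in> T" using m(1) assms(2) by blast
  then show False
  proof
    assume "m \<in> S"
    then show False using key[OF assms(2,3) _ _ cross] ne by blast
  next
    assume "m \<in> T"
    moreover have "T \<union> S = A" "T \<inter> S = {}" using assms(2,3) by auto
    ultimately show False using key[of T S] cross ne by blast
  qed
qed

text \<open>Let \<open>?S\<close> collect the elements on which the two partitions agree and
  \<open>?T\<close> the others. An element of \<open>?S\<close> and one of \<open>?T\<close> always
  share a chain of one of the partitions, so they are comparable.\<close>

lemma two_chain_partition_unique:
  assumes "irreducible_poset A r" "two_chain_partition A r C\<^sub>1 C\<^sub>2" "two_chain_partition A r D\<^sub>1 D\<^sub>2"
  shows "(D\<^sub>1 = C\<^sub>1 \<and> D\<^sub>2 = C\<^sub>2) \<or> (D\<^sub>1 = C\<^sub>2 \<and> D\<^sub>2 = C\<^sub>1)"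
proof -
  let ?S = "(C\<^sub>1 \<inter> D\<^sub>1) \<union> (C\<^sub>2 \<inter> D\<^sub>2)" and ?T = "(C\<^sub>1 \<inter> D\<^sub>2) \<union> (C\<^sub>2 \<inter> D\<^sub>1)"
  note parts = assms(2,3)[unfolded two_chain_partition_def]
  have "?S = {} \<or> ?T = {}"
  proof (rule irreducible_if_cross_comparable[OF assms(1)])
    show "?S \<union> ?T = A" using parts by blast
    show "?S \<inter> ?T = {}" using parts by blast
    show "(x, y) \<in> r \<or> (y, x) \<in> r" if "x \<in> ?S" "y \<in> ?T" for x y
      using that parts unfolding Chains_def by blast
  qed
  then show ?thesis
  proof
    assume "?S = {}"
    then have "D\<^sub>1 = C\<^sub>2 \<and> D\<^sub>2 = C\<^sub>1" using parts by blast
    then show ?thesis ..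
  next
    assume "?T = {}"
    then have "D\<^sub>1 = C\<^sub>1 \<and> D\<^sub>2 = C\<^sub>2" using parts by blast
    then show ?thesis ..
  qed
qed

end

lemma naturally_labeled_fin_poset: "naturally_labeled n r \<Longrightarrow> fin_poset {1..n} r"
  unfolding naturally_labeled_def fin_poset_def by simp

theorem theorem4p5:
  fixes n :: nat and P :: "(nat \<times> nat) set"
  assumes "naturally_labeled n P"
    and "poset_width {1..n} P \<le> 2"
  shows "(\<forall>m Q. naturally_labeled m Q \<and> K {1..m} Q = K {1..n} P \<longrightarrow>
            poset_iso {1..m} Q {1..n} P) \<and>
         (irreducible_poset {1..n} P \<longrightarrow>
            (\<exists>C\<^sub>1 C\<^sub>2. two_chain_partition {1..n} P C\<^sub>1 C\<^sub>2 \<and>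
               (\<forall>D\<^sub>1 D\<^sub>2. two_chain_partition {1..n} P D\<^sub>1 D\<^sub>2 \<longrightarrow>
                  (D\<^sub>1 = C\<^sub>1 \<and> D\<^sub>2 = C\<^sub>2) \<or> (D\<^sub>1 = C\<^sub>2 \<and> D\<^sub>2 = C\<^sub>1))))"
proof (intro conjI allI impI)
  note P = naturally_labeled_fin_poset[OF assms(1)]
  fix m Q assume "naturally_labeled m Q \<and> K {1..m} Q = K {1..n} P"
  then have "fin_poset {1..m} Q" "K {1..n} P = K {1..m} Q"
    using naturally_labeled_fin_poset by auto
  then show "poset_iso {1..m} Q {1..n} P"
    using poset_iso_sym poset_iso_if_K_eq[OF P _ _ assms(2)] by blast
next
  note P = naturally_labeled_fin_poset[OF assms(1)]
  assume irr: "irreducible_poset {1..n} P"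
  obtain C\<^sub>1 C\<^sub>2 where "two_chains {1..n} P C\<^sub>1 C\<^sub>2"
    using two_chains_if_width_le_two[OF P assms(2)] by blast
  then have C: "two_chain_partition {1..n} P C\<^sub>1 C\<^sub>2" by (rule two_chains.partition)
  show "\<exists>C\<^sub>1 C\<^sub>2. two_chain_partition {1..n} P C\<^sub>1 C\<^sub>2 \<and>
      (\<forall>D\<^sub>1 D\<^sub>2. two_chain_partition {1..n} P D\<^sub>1 D\<^sub>2 \<longrightarrow>
        (D\<^sub>1 = C\<^sub>1 \<and> D\<^sub>2 = C\<^sub>2) \<or> (D\<^sub>1 = C\<^sub>2 \<and> D\<^sub>2 = C\<^sub>1))"
    using C fin_poset.two_chain_partition_unique[OF P irr C] by (intro exI[of _ C\<^sub>1] exI[of _ C\<^sub>2]) simp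
qed

end
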